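(* Let $\Bbbk$ be an algebraically closed field of characteristic $0$ and let $P=\Bbbk[x_1,x_2,x_3]$ be a unimodular quadratic Poisson algebra. Let $G$ be a finite subgroup of the graded Poisson automorphism group of $P$, let $P_\hbar$ be the standard deformation quantization of $P$ with $\hbar$ viewed as a formal parameter, and let $G_\hbar$ be the finite group of graded automorphisms of $P_\hbar$ corresponding to $G$. Define $Q_\hbar:=P_\hbar^{G_\hbar}$. Then: (1) $Q_\hbar/(\hbar)\cong P^G$ as $\Bbbk$-algebras. (2) For all $f,g\in Q_\hbar$, $fg-gf=\hbar\,\pi_1(f,g)$ for some $\pi_1(f,g)\in Q_\hbar$. (3) $Q_\hbar/(\hbar)$ together with the Poisson bracket $\{\overline f,\overline g\}=\overline{\pi_1(f,g)}$, where $\overline{(\ )}$ denotes the image under the natural projection $Q_\hbar\to Q_\hbar/(\hbar)$, is isomorphic to $P^G$ as Poisson algebras.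
   Context: A Poisson algebra is a commutative $\Bbbk$-algebra with a Lie bracket $\{-,-\}$ satisfying the Leibniz rule $\{a,bc\}=b\{a,c\}+\{a,b\}c$. $P=\Bbbk[x_1,x_2,x_3]$ carries the standard grading. It is quadratic if $\{P_1,P_1\}\subseteq P_2$, and unimodular if there is a homogeneous polynomial $\Omega$ in $x_1,x_2,x_3$ with $\{x_1,x_2\}=\partial\Omega/\partial x_3$, $\{x_2,x_3\}=\partial\Omega/\partial x_1$, $\{x_3,x_1\}=\partial\Omega/\partial x_2$. Write $\{x_i,x_j\}=\sum_{k,l}c_{i,j}^{k,l}x_kx_l$ with $c_{i,j}^{k,l}\in\Bbbk$. The standard deformation quantization with $\hbar$ a formal parameter is the $\Bbbk[[\hbar]]$-algebra $$P_\hbar=\Bbbk[[\hbar]]\langle y_1,y_2,y_3\rangle\Big/\Big([y_i,y_j]=\tfrac{\hbar}{2}\sum_{k,l}c_{i,j}^{k,l}(y_ky_l+y_ly_k)\Big)_{1\le i,j\le3},$$ graded by $\deg y_i=1$, $\deg\hbar=0$. A graded Poisson automorphism $\phi\in G$, $\phi(x_i)=\sum_j a_{ij}x_j$ with $a_{ij}\in\Bbbk$, corresponds to the graded $\Bbbk[[\hbar]]$-algebra automorphism $y_i\mapsto\sum_j a_{ij}y_j$ of $P_\hbar$ (same matrix); $G_\hbar$ is the group of all these automorphisms for $\phi\in G$. $P^G$ is the invariant subalgebra, with the Poisson bracket restricted from $P$. $(\hbar)$ denotes the ideal $\hbar Q_\hbar$ of $Q_\hbar$. *)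

theory Defs
  imports
    "HOL-Library.Poly_Mapping"
    "HOL-Library.Numeral_Type"
    "HOL-Computational_Algebra.Formal_Power_Series"
    "HOL-Algebra.Algebra"
    "HOL-Algebra.Algebraic_Closure_Type"
begin

section \<open>Poisson algebras over a commutative ring\<close>

record ('a, 'b) poisson = "('a, 'b) module" +
  pbracket :: "'b \<Rightarrow> 'b \<Rightarrow> 'b"  (\<open>(\<open>notation=\<open>mixfix pbracket\<close>\<close>\<lbrace>_,/ _\<rbrace>\<index>)\<close>)

locale poisson_algebra = algebra K A
  for K :: "('a, 'm) ring_scheme" (structure) and A :: "('a, 'b, 'n) poisson_scheme" (structure) +
  assumes bracket_closed:
      "\<lbrakk>x \<in> carrier A; y \<in> carrier A\<rbrakk> \<Longrightarrow> \<lbrace>x, y\<rbrace>\<^bsub>A\<^esub> \<in> carrier A"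
    and bracket_add_l:
      "\<lbrakk>x \<in> carrier A; y \<in> carrier A; z \<in> carrier A\<rbrakk>
        \<Longrightarrow> \<lbrace>x \<oplus>\<^bsub>A\<^esub> y, z\<rbrace>\<^bsub>A\<^esub> = \<lbrace>x, z\<rbrace>\<^bsub>A\<^esub> \<oplus>\<^bsub>A\<^esub> \<lbrace>y, z\<rbrace>\<^bsub>A\<^esub>"
    and bracket_add_r:
      "\<lbrakk>x \<in> carrier A; y \<in> carrier A; z \<in> carrier A\<rbrakk>
        \<Longrightarrow> \<lbrace>x, y \<oplus>\<^bsub>A\<^esub> z\<rbrace>\<^bsub>A\<^esub> = \<lbrace>x, y\<rbrace>\<^bsub>A\<^esub> \<oplus>\<^bsub>A\<^esub> \<lbrace>x, z\<rbrace>\<^bsub>A\<^esub>"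
    and bracket_smult_l:
      "\<lbrakk>a \<in> carrier K; x \<in> carrier A; y \<in> carrier A\<rbrakk>
        \<Longrightarrow> \<lbrace>a \<odot>\<^bsub>A\<^esub> x, y\<rbrace>\<^bsub>A\<^esub> = a \<odot>\<^bsub>A\<^esub> \<lbrace>x, y\<rbrace>\<^bsub>A\<^esub>"
    and bracket_smult_r:
      "\<lbrakk>a \<in> carrier K; x \<in> carrier A; y \<in> carrier A\<rbrakk>
        \<Longrightarrow> \<lbrace>x, a \<odot>\<^bsub>A\<^esub> y\<rbrace>\<^bsub>A\<^esub> = a \<odot>\<^bsub>A\<^esub> \<lbrace>x, y\<rbrace>\<^bsub>A\<^esub>"
    and bracket_self:
      "x \<in> carrier A \<Longrightarrow> \<lbrace>x, x\<rbrace>\<^bsub>A\<^esub> = \<zero>\<^bsub>A\<^esub>"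
    and bracket_jacobi:
      "\<lbrakk>x \<in> carrier A; y \<in> carrier A; z \<in> carrier A\<rbrakk>
        \<Longrightarrow> \<lbrace>x, \<lbrace>y, z\<rbrace>\<^bsub>A\<^esub>\<rbrace>\<^bsub>A\<^esub> \<oplus>\<^bsub>A\<^esub> \<lbrace>y, \<lbrace>z, x\<rbrace>\<^bsub>A\<^esub>\<rbrace>\<^bsub>A\<^esub> \<oplus>\<^bsub>A\<^esub> \<lbrace>z, \<lbrace>x, y\<rbrace>\<^bsub>A\<^esub>\<rbrace>\<^bsub>A\<^esub> = \<zero>\<^bsub>A\<^esub>"
    and bracket_leibniz:
      "\<lbrakk>x \<in> carrier A; y \<in> carrier A; z \<in> carrier A\<rbrakk>
        \<Longrightarrow> \<lbrace>x, y \<otimes>\<^bsub>A\<^esub> z\<rbrace>\<^bsub>A\<^esub> = y \<otimes>\<^bsub>A\<^esub> \<lbrace>x, z\<rbrace>\<^bsub>A\<^esub> \<oplus>\<^bsub>A\<^esub> \<lbrace>x, y\<rbrace>\<^bsub>A\<^esub> \<otimes>\<^bsub>A\<^esub> z"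

definition algebra_iso ::
  "('a, 'm) ring_scheme \<Rightarrow> ('a, 'b, 'n) module_scheme \<Rightarrow> ('a, 'c, 'p) module_scheme \<Rightarrow> ('b \<Rightarrow> 'c) set"
  where "algebra_iso K A B = {h \<in> ring_iso A B.
    \<forall>a \<in> carrier K. \<forall>x \<in> carrier A. h (a \<odot>\<^bsub>A\<^esub> x) = a \<odot>\<^bsub>B\<^esub> h x}"

definition poisson_iso ::
  "('a, 'm) ring_scheme \<Rightarrow> ('a, 'b, 'n) poisson_scheme \<Rightarrow> ('a, 'c, 'p) poisson_scheme \<Rightarrow> ('b \<Rightarrow> 'c) set"
  where "poisson_iso K A B = {h \<in> algebra_iso K A B.
    \<forall>x \<in> carrier A. \<forall>y \<in> carrier A. h \<lbrace>x, y\<rbrace>\<^bsub>A\<^esub> = \<lbrace>h x, h y\<rbrace>\<^bsub>B\<^esub>}"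

definition isomorphic_algebras ::
  "('a, 'm) ring_scheme \<Rightarrow> ('a, 'b, 'n) module_scheme \<Rightarrow> ('a, 'c, 'p) module_scheme \<Rightarrow> bool"
  where "isomorphic_algebras K A B \<longleftrightarrow>
    algebra K A \<and> algebra K B \<and> algebra_iso K A B \<noteq> {}"

definition isomorphic_poisson_algebras ::
  "('a, 'm) ring_scheme \<Rightarrow> ('a, 'b, 'n) poisson_scheme \<Rightarrow> ('a, 'c, 'p) poisson_scheme \<Rightarrow> bool"
  where "isomorphic_poisson_algebras K A B \<longleftrightarrow>
    poisson_algebra K A \<and> poisson_algebra K B \<and> poisson_iso K A B \<noteq> {}"

text \<open>The ring \<open>R\<close> as an algebra through the structure map \<open>s\<close>.\<close>

definition algebra_via :: "('b, 'm) ring_scheme \<Rightarrow> ('a \<Rightarrow> 'b) \<Rightarrow> ('a, 'b) module"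
  where "algebra_via R s = \<lparr>carrier = carrier R, monoid.mult = monoid.mult R, one = one R,
    ring.zero = ring.zero R, add = add R, module.smult = (\<lambda>a x. s a \<otimes>\<^bsub>R\<^esub> x)\<rparr>"

definition with_bracket :: "('a, 'b) module \<Rightarrow> ('b \<Rightarrow> 'b \<Rightarrow> 'b) \<Rightarrow> ('a, 'b) poisson"
  where "with_bracket M B = module.extend M (poisson.fields B)"


section \<open>Poisson structures on \<open>k[x\<^sub>1, x\<^sub>2, x\<^sub>3]\<close>\<close>

text \<open>
  Exponent vectors are finitely supported maps on the three-element type \<open>3\<close>, whose elements are
  \<open>1\<close>, \<open>2\<close> and \<open>3\<close>; as \<open>3 = 0\<close> in this type, the variable \<open>x\<^sub>3\<close> may also be written \<open>x\<^sub>0\<close>.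
\<close>

type_synonym 'k pol = "(3 \<Rightarrow>\<^sub>0 nat) \<Rightarrow>\<^sub>0 'k"

definition pconst :: "'k::field \<Rightarrow> 'k pol"
  where "pconst a = Poly_Mapping.single 0 a"

definition pvar :: "3 \<Rightarrow> 'k::field pol"
  where "pvar i = Poly_Mapping.single (Poly_Mapping.single i 1) 1"

definition mon_degree :: "(3 \<Rightarrow>\<^sub>0 nat) \<Rightarrow> nat"
  where "mon_degree m = (\<Sum>i\<in>UNIV. Poly_Mapping.lookup m i)"

definition pol_part :: "nat \<Rightarrow> 'k::field pol set"
  where "pol_part d = {p. \<forall>m \<in> Poly_Mapping.keys p. mon_degree m = d}"

definition pderivative :: "3 \<Rightarrow> 'k::field pol \<Rightarrow> 'k pol"
  where "pderivative i p = (\<Sum>m\<in>Poly_Mapping.keys p.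
    Poly_Mapping.single (m - Poly_Mapping.single i 1)
      (of_nat (Poly_Mapping.lookup m i) * Poly_Mapping.lookup p m))"

definition pol_algebra :: "('k::field, 'k pol) module"
  where "pol_algebra = algebra_via ring_of_type_algebra pconst"

definition pol_poisson :: "('k::field pol \<Rightarrow> 'k pol \<Rightarrow> 'k pol) \<Rightarrow> ('k, 'k pol) poisson"
  where "pol_poisson br = with_bracket pol_algebra br"

definition quadratic :: "('k::field pol \<Rightarrow> 'k pol \<Rightarrow> 'k pol) \<Rightarrow> bool"
  where "quadratic br \<longleftrightarrow> (\<forall>f \<in> pol_part 1. \<forall>g \<in> pol_part 1. br f g \<in> pol_part 2)"

definition unimodular :: "('k::field pol \<Rightarrow> 'k pol \<Rightarrow> 'k pol) \<Rightarrow> bool"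
  where "unimodular br \<longleftrightarrow> (\<exists>\<Omega> d. \<Omega> \<in> pol_part d \<and>
    br (pvar 1) (pvar 2) = pderivative 3 \<Omega> \<and>
    br (pvar 2) (pvar 3) = pderivative 1 \<Omega> \<and>
    br (pvar 3) (pvar 1) = pderivative 2 \<Omega>)"

definition graded_poisson_Aut :: "('k::field pol \<Rightarrow> 'k pol \<Rightarrow> 'k pol) \<Rightarrow> ('k pol \<Rightarrow> 'k pol) monoid"
  where "graded_poisson_Aut br =
    \<lparr>carrier = {\<phi> \<in> poisson_iso ring_of_type_algebra (pol_poisson br) (pol_poisson br).
        \<forall>d. \<phi> ` pol_part d \<subseteq> pol_part d},
     monoid.mult = (\<circ>), one = id\<rparr>"

definition pol_invariants ::
  "('k::field pol \<Rightarrow> 'k pol \<Rightarrow> 'k pol) \<Rightarrow> ('k pol \<Rightarrow> 'k pol) set \<Rightarrow> ('k, 'k pol) poisson"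
  where "pol_invariants br G = (pol_poisson br)\<lparr>carrier := {p. \<forall>\<phi> \<in> G. \<phi> p = p}\<rparr>"

text \<open>The matrix \<open>a\<close> with \<open>\<phi> x\<^sub>i = \<Sum>\<^sub>j a\<^sub>i\<^sub>j x\<^sub>j\<close>.\<close>

definition linear_matrix :: "('k::field pol \<Rightarrow> 'k pol) \<Rightarrow> 3 \<Rightarrow> 3 \<Rightarrow> 'k"
  where "linear_matrix \<phi> i j = Poly_Mapping.lookup (\<phi> (pvar i)) (Poly_Mapping.single j 1)"


section \<open>The free algebra \<open>k[[\<hbar>]]\<langle>y\<^sub>1, y\<^sub>2, y\<^sub>3\<rangle>\<close>\<close>

text \<open>
  The free monoid, written additively because \<^typ>\<open>'a \<Rightarrow>\<^sub>0 'b\<close> takes its convolution product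
  from a (not necessarily commutative) addition on the exponents.
\<close>

datatype 'v free_monoid = Letters (letters: "'v list")

instantiation free_monoid :: (type) monoid_add
begin

definition zero_free_monoid :: "'a free_monoid"
  where "0 = Letters []"

definition plus_free_monoid :: "'a free_monoid \<Rightarrow> 'a free_monoid \<Rightarrow> 'a free_monoid"
  where "u + v = Letters (letters u @ letters v)"

instance
  by standard (simp_all add: zero_free_monoid_def plus_free_monoid_def)

end

type_synonym 'k nc_pol = "3 free_monoid \<Rightarrow>\<^sub>0 'k fps"

definition nc_const :: "'k::field fps \<Rightarrow> 'k nc_pol"
  where "nc_const a = Poly_Mapping.single 0 a"

definition nc_var :: "3 \<Rightarrow> 'k::field nc_pol"
  where "nc_var i = Poly_Mapping.single (Letters [i]) 1"

definition nc_linear_subst :: "(3 \<Rightarrow> 3 \<Rightarrow> 'k::field) \<Rightarrow> 'k nc_pol \<Rightarrow> 'k nc_pol"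
  where "nc_linear_subst a p = (\<Sum>w\<in>Poly_Mapping.keys p. nc_const (Poly_Mapping.lookup p w) *
    prod_list (map (\<lambda>i. \<Sum>j\<in>UNIV. nc_const (fps_const (a i j)) * nc_var j) (letters w)))"


section \<open>The standard deformation quantization and its invariants\<close>

text \<open>
  The argument \<open>c i j k l\<close> is the structure constant \<open>c\<^sub>i\<^sub>,\<^sub>j\<^sup>k\<^sup>,\<^sup>l\<close>, and the formal parameter
  \<open>\<hbar>\<close> is \<^const>\<open>fps_X\<close>.
\<close>

definition quantization_relation :: "(3 \<Rightarrow> 3 \<Rightarrow> 3 \<Rightarrow> 3 \<Rightarrow> 'k::field) \<Rightarrow> 3 \<Rightarrow> 3 \<Rightarrow> 'k nc_pol"
  where "quantization_relation c i j = (nc_var i * nc_var j - nc_var j * nc_var i)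
    - nc_const (fps_X * fps_const (1 / 2)) * (\<Sum>k\<in>UNIV. \<Sum>l\<in>UNIV.
        nc_const (fps_const (c i j k l)) * (nc_var k * nc_var l + nc_var l * nc_var k))"

definition quantization_ideal :: "(3 \<Rightarrow> 3 \<Rightarrow> 3 \<Rightarrow> 3 \<Rightarrow> 'k::field) \<Rightarrow> 'k nc_pol set"
  where "quantization_ideal c =
    Idl\<^bsub>ring_of_type_algebra\<^esub> {quantization_relation c i j | i j. True}"

definition quantization :: "(3 \<Rightarrow> 3 \<Rightarrow> 3 \<Rightarrow> 3 \<Rightarrow> 'k::field) \<Rightarrow> 'k nc_pol set ring"
  where "quantization c = ring_of_type_algebra Quot quantization_ideal c"

definition quantization_class :: "(3 \<Rightarrow> 3 \<Rightarrow> 3 \<Rightarrow> 3 \<Rightarrow> 'k::field) \<Rightarrow> 'k nc_pol \<Rightarrow> 'k nc_pol set"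
  where "quantization_class c p = quantization_ideal c +>\<^bsub>ring_of_type_algebra\<^esub> p"

definition hbar :: "(3 \<Rightarrow> 3 \<Rightarrow> 3 \<Rightarrow> 3 \<Rightarrow> 'k::field) \<Rightarrow> 'k nc_pol set"
  where "hbar c = quantization_class c (nc_const fps_X)"

text \<open>
  The map \<open>y\<^sub>i \<mapsto> \<Sum>\<^sub>j a\<^sub>i\<^sub>j y\<^sub>j\<close> on the quotient: a coset is sent to the coset of the image of any of
  its members. The union ranges over equal sets whenever the substitution preserves the ideal,
  which is the case for the matrix of a graded Poisson automorphism.
\<close>

definition quantization_map ::
  "(3 \<Rightarrow> 3 \<Rightarrow> 3 \<Rightarrow> 3 \<Rightarrow> 'k::field) \<Rightarrow> (3 \<Rightarrow> 3 \<Rightarrow> 'k) \<Rightarrow> 'k nc_pol set \<Rightarrow> 'k nc_pol set"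
  where "quantization_map c a C = (\<Union>p\<in>C. quantization_class c (nc_linear_subst a p))"

definition quantized_group ::
  "(3 \<Rightarrow> 3 \<Rightarrow> 3 \<Rightarrow> 3 \<Rightarrow> 'k::field) \<Rightarrow> ('k pol \<Rightarrow> 'k pol) set \<Rightarrow> ('k nc_pol set \<Rightarrow> 'k nc_pol set) set"
  where "quantized_group c G = (\<lambda>\<phi>. quantization_map c (linear_matrix \<phi>)) ` G"

definition quantized_invariants ::
  "(3 \<Rightarrow> 3 \<Rightarrow> 3 \<Rightarrow> 3 \<Rightarrow> 'k::field) \<Rightarrow> ('k pol \<Rightarrow> 'k pol) set \<Rightarrow> 'k nc_pol set ring"
  where "quantized_invariants c G = (quantization c)
    \<lparr>carrier := {f \<in> carrier (quantization c). \<forall>\<psi> \<in> quantized_group c G. \<psi> f = f}\<rparr>"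

definition hbar_ideal ::
  "(3 \<Rightarrow> 3 \<Rightarrow> 3 \<Rightarrow> 3 \<Rightarrow> 'k::field) \<Rightarrow> ('k pol \<Rightarrow> 'k pol) set \<Rightarrow> 'k nc_pol set set"
  where "hbar_ideal c G =
    {hbar c \<otimes>\<^bsub>quantized_invariants c G\<^esub> f | f. f \<in> carrier (quantized_invariants c G)}"

definition residue_class ::
  "(3 \<Rightarrow> 3 \<Rightarrow> 3 \<Rightarrow> 3 \<Rightarrow> 'k::field) \<Rightarrow> ('k pol \<Rightarrow> 'k pol) set \<Rightarrow> 'k nc_pol set \<Rightarrow> 'k nc_pol set set"
  where "residue_class c G f = hbar_ideal c G +>\<^bsub>quantized_invariants c G\<^esub> f"

definition residue_algebra ::
  "(3 \<Rightarrow> 3 \<Rightarrow> 3 \<Rightarrow> 3 \<Rightarrow> 'k::field) \<Rightarrow> ('k pol \<Rightarrow> 'k pol) set \<Rightarrow> ('k, 'k nc_pol set set) module"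
  where "residue_algebra c G = algebra_via (quantized_invariants c G Quot hbar_ideal c G)
    (\<lambda>a. residue_class c G (quantization_class c (nc_const (fps_const a))))"

end

theory Submission
  imports Defs
begin

text \<open>
  Let \<open>F\<close> be the free algebra \<open>k[[\<hbar>]]\<langle>y\<^sub>1, y\<^sub>2, y\<^sub>3\<rangle>\<close> and \<open>I\<close> the ideal of the quantization relations, so that
  \<open>P\<^sub>\<hbar> = F / I\<close>. Everything follows from two additive maps \<open>F \<rightarrow> P\<close>, the coefficients of \<open>1\<close> and of \<open>\<hbar>\<close> in
  the star product.

  Modulo \<open>\<hbar>\<^sup>2\<close> the star product is \<open>f \<star> g = f g + (\<hbar>/2) {f, g}\<close>. It makes \<open>P \<oplus> \<hbar>P\<close> an associative
  algebra because the bracket is a derivation in each argument. Sending \<open>y\<^sub>i\<close> to \<open>x\<^sub>i\<close> therefore gives an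
  algebra homomorphism from \<open>F\<close>; its components are \<open>reduction\<close> and \<open>first_order br\<close>. It
  respects the quantization relations, as the commutator of \<open>x\<^sub>i\<close> and \<open>x\<^sub>j\<close> is
  \<open>\<hbar> {x\<^sub>i, x\<^sub>j}\<close>, so both maps vanish on \<open>I\<close> (\<open>quantization_ideal_first_order\<close>). Applying the
  second one to \<open>p q - q p - \<hbar> r \<in> I\<close> yields \<open>{p, q}\<close> minus \<open>r\<close>, all reduced modulo \<open>\<hbar>\<close>. Hence any \<open>r\<close>
  for which \<open>\<hbar> r\<close> is the commutator of \<open>p\<close> and \<open>q\<close> in \<open>P\<^sub>\<hbar>\<close> reduces to the Poisson bracket
  (\<open>reduction_commutator_quotient\<close>).

  The kernel of the reduction is \<open>I + \<hbar>F\<close>, since modulo that ideal the letters commute and a word is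
  determined by its monomial (\<open>reduction_eq_zeroD\<close>). A graded Poisson automorphism \<open>\<phi>\<close> acts on \<open>F\<close> by its
  matrix. It turns each relation into a linear combination of relations, because \<open>\<phi>\<close>
  preserves the bracket and the relations involve only symmetrised products
  (\<open>nc_linear_subst_quantization_relation\<close>). Averaging over the finite group, which is possible in
  characteristic \<open>0\<close>, lifts invariant polynomials to invariants of \<open>P\<^sub>\<hbar>\<close>. It also shows that an invariant
  element that reduces to \<open>0\<close> is \<open>\<hbar>\<close> times an invariant one. So the reduction induces a surjection
  \<open>Q\<^sub>\<hbar> \<rightarrow> P\<^sup>G\<close> with kernel \<open>\<hbar> Q\<^sub>\<hbar>\<close> (\<open>class_reduction_surj\<close>, \<open>kernel_class_reduction\<close>), which is the
  first claim. Commutators reduce to \<open>0\<close>, which is the second one. For the third,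
  the bracket of \<open>P\<^sup>G\<close> is pulled back along the isomorphism, and the formula for
  \<open>r\<close> above says that the result is the bracket induced by the commutator.
\<close>

section \<open>Additive maps on finitely supported functions\<close>

lemma poly_mapping_additive_induct [case_names zero single add]:
  assumes "P 0" and "\<And>w a. P (Poly_Mapping.single w a)"
    and "\<And>p q. P p \<Longrightarrow> P q \<Longrightarrow> P (p + q)"
  shows "P (p :: 'w \<Rightarrow>\<^sub>0 'a::monoid_add)"
proof (induction p rule: Poly_Mapping.update_induct)
  case const
  show ?case by (rule assms)
next
  case (update p w a)
  have "Poly_Mapping.update w a p = p + Poly_Mapping.single w a"
    using update.hyps
    by (intro poly_mapping_eqI) (auto simp: lookup_update lookup_add lookup_single in_keys_iff when_def)
  then show ?case using update assms by simp
qed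

text \<open>
  Identities between additive or biadditive expressions need only be checked on monomials. In
  this way the maps on polynomials below are seen to be multiplicative.
\<close>

lemma additive_eqI:
  fixes f g :: "('w \<Rightarrow>\<^sub>0 'a::monoid_add) \<Rightarrow> 'b::ab_group_add"
  assumes f: "\<And>p q. f (p + q) = f p + f q" and g: "\<And>p q. g (p + q) = g p + g q"
    and single: "\<And>w a. f (Poly_Mapping.single w a) = g (Poly_Mapping.single w a)"
  shows "f p = g p"
proof (induction p rule: poly_mapping_additive_induct)
  case zero
  show ?case using f[of 0 0] g[of 0 0] by simp
qed (simp_all add: assms)

lemma biadditive_eqI:
  fixes f g :: "('w \<Rightarrow>\<^sub>0 'a::monoid_add) \<Rightarrow> ('v \<Rightarrow>\<^sub>0 'c::monoid_add) \<Rightarrow> 'b::ab_group_add"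
  assumes "\<And>p p' q. f (p + p') q = f p q + f p' q" "\<And>p q q'. f p (q + q') = f p q + f p q'"
    and "\<And>p p' q. g (p + p') q = g p q + g p' q" "\<And>p q q'. g p (q + q') = g p q + g p q'"
    and "\<And>w a u b. f (Poly_Mapping.single w a) (Poly_Mapping.single u b)
          = g (Poly_Mapping.single w a) (Poly_Mapping.single u b)"
  shows "f p q = g p q"
  by (rule additive_eqI[of "\<lambda>p. f p q" "\<lambda>p. g p q"], simp_all add: assms)
     (rule additive_eqI, simp_all add: assms)

definition additive_extension :: "('w \<Rightarrow> 'a \<Rightarrow> 'b) \<Rightarrow> ('w \<Rightarrow>\<^sub>0 'a::zero) \<Rightarrow> 'b::comm_monoid_add"
  where "additive_extension F p = (\<Sum>w\<in>Poly_Mapping.keys p. F w (Poly_Mapping.lookup p w))"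

lemma additive_extension_add:
  assumes "\<And>w. F w 0 = 0" "\<And>w a b. F w (a + b) = F w a + F w b"
  shows "additive_extension F (p + q) = additive_extension F p + additive_extension F q"
  unfolding additive_extension_def by (rule setsum_keys_plus_distrib) (simp_all add: assms)

lemma additive_extension_single:
  assumes "\<And>w. F w 0 = 0"
  shows "additive_extension F (Poly_Mapping.single w a) = F w a"
  by (simp add: additive_extension_def assms)


section \<open>Evaluation of noncommutative polynomials\<close>

lemma sum_swap_pairs:
  "(\<Sum>k\<in>A. \<Sum>l\<in>B. \<Sum>p\<in>C. \<Sum>q\<in>D. F k l p q) = (\<Sum>p\<in>C. \<Sum>q\<in>D. \<Sum>k\<in>A. \<Sum>l\<in>B. F k l p q)"
proof -
  have "(\<Sum>k\<in>A. \<Sum>l\<in>B. \<Sum>p\<in>C. \<Sum>q\<in>D. F k l p q) = (\<Sum>k\<in>A. \<Sum>p\<in>C. \<Sum>q\<in>D. \<Sum>l\<in>B. F k l p q)"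
    by (intro sum.cong refl) (subst sum.swap, intro sum.cong refl, rule sum.swap)
  also have "\<dots> = (\<Sum>p\<in>C. \<Sum>q\<in>D. \<Sum>k\<in>A. \<Sum>l\<in>B. F k l p q)"
    by (subst sum.swap, intro sum.cong refl, rule sum.swap)
  finally show ?thesis .
qed

text \<open>
  A ring \<open>'r\<close> that is an algebra over \<open>'a\<close> through a homomorphism \<open>\<kappa>\<close> with central image. The same
  computations occur for \<open>F\<close> over \<open>k\<close> and over \<open>k[[\<hbar>]]\<close>, and for \<open>P\<close> over \<open>k\<close> and over \<open>k[[\<hbar>]]\<close> with \<open>\<hbar>\<close>
  acting as \<open>0\<close>; these are the four interpretations \<open>scalar\<close>, \<open>nc\<close>, \<open>pol\<close> and \<open>classical\<close>.
\<close>

locale central_constants =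
  fixes \<kappa> :: "'a::comm_ring_1 \<Rightarrow> 'r::ring_1"
  assumes const_add: "\<kappa> (a + b) = \<kappa> a + \<kappa> b"
    and const_mult: "\<kappa> (a * b) = \<kappa> a * \<kappa> b"
    and const_one: "\<kappa> 1 = 1"
    and const_central: "\<kappa> a * r = r * \<kappa> a"
begin

lemma const_zero: "\<kappa> 0 = 0"
  using const_add[of 0 0] by simp

lemma const_uminus: "\<kappa> (- a) = - \<kappa> a"
  using const_add[of a "- a"] by (simp add: const_zero eq_neg_iff_add_eq_0 add.commute)

lemma const_diff: "\<kappa> (a - b) = \<kappa> a - \<kappa> b"
  using const_add[of a "- b"] by (simp add: const_uminus)

lemma const_sum: "\<kappa> (sum f A) = (\<Sum>x\<in>A. \<kappa> (f x))"
  by (induction A rule: infinite_finite_induct) (simp_all add: const_zero const_add)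

lemma const_of_nat: "\<kappa> (of_nat n) = of_nat n"
  by (induction n) (simp_all add: const_zero const_add const_one)

lemma const_factors: "(\<kappa> a * r) * (\<kappa> b * s) = \<kappa> (a * b) * (r * s)"
  by (metis const_central const_mult mult.assoc)

lemma linear_form_product:
  "(\<Sum>p\<in>A. \<kappa> (f p) * v p) * (\<Sum>q\<in>B. \<kappa> (g q) * v q)
    = (\<Sum>p\<in>A. \<Sum>q\<in>B. \<kappa> (f p * g q) * (v p * v q))"
  by (simp add: sum_product const_factors)

lemma substituted_quadratic_form:
  "(\<Sum>k\<in>UNIV. \<Sum>l\<in>UNIV. \<kappa> (d k l) * ((\<Sum>p\<in>UNIV. \<kappa> (f k p) * v p) * (\<Sum>q\<in>UNIV. \<kappa> (f l q) * v q)))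
    = (\<Sum>p\<in>UNIV. \<Sum>q\<in>UNIV. \<kappa> (\<Sum>k\<in>UNIV. \<Sum>l\<in>UNIV. d k l * (f k p * f l q)) * (v p * v q))"
  for d :: "'i::finite \<Rightarrow> 'i \<Rightarrow> 'a" and f :: "'i \<Rightarrow> 'j::finite \<Rightarrow> 'a"
proof -
  have "(\<Sum>k\<in>UNIV. \<Sum>l\<in>UNIV. \<kappa> (d k l) * ((\<Sum>p\<in>UNIV. \<kappa> (f k p) * v p) * (\<Sum>q\<in>UNIV. \<kappa> (f l q) * v q)))
    = (\<Sum>k\<in>UNIV. \<Sum>l\<in>UNIV. \<Sum>p\<in>UNIV. \<Sum>q\<in>UNIV. \<kappa> (d k l * (f k p * f l q)) * (v p * v q))"
    unfolding linear_form_product by (simp add: sum_distrib_left const_mult mult.assoc)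
  also have "\<dots> = (\<Sum>p\<in>UNIV. \<Sum>q\<in>UNIV. \<Sum>k\<in>UNIV. \<Sum>l\<in>UNIV. \<kappa> (d k l * (f k p * f l q)) * (v p * v q))"
    by (rule sum_swap_pairs)
  finally show ?thesis
    by (simp add: const_sum sum_distrib_right)
qed

text \<open>
  The homomorphism given by the universal property of the free algebra.
\<close>

definition evaluation :: "('v \<Rightarrow> 'r) \<Rightarrow> ('v free_monoid \<Rightarrow>\<^sub>0 'a) \<Rightarrow> 'r"
  where "evaluation v = additive_extension (\<lambda>w a. \<kappa> a * prod_list (map v (letters w)))"

lemma evaluation_add: "evaluation v (p + q) = evaluation v p + evaluation v q"
  unfolding evaluation_def
  by (rule additive_extension_add) (simp_all add: const_zero const_add distrib_right)

lemma evaluation_single: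
  "evaluation v (Poly_Mapping.single w a) = \<kappa> a * prod_list (map v (letters w))"
  unfolding evaluation_def by (rule additive_extension_single) (simp add: const_zero)

lemma evaluation_mult: "evaluation v (p * q) = evaluation v p * evaluation v q"
  by (rule biadditive_eqI)
     (simp_all add: distrib_left distrib_right evaluation_add mult_single evaluation_single
       plus_free_monoid_def const_factors)

end

interpretation nc: central_constants "nc_const :: 'k::field fps \<Rightarrow> 'k nc_pol"
proof
  fix a b :: "'k fps" and r :: "'k nc_pol"
  show "nc_const (a + b) = nc_const a + nc_const b" by (simp add: nc_const_def single_add)
  show "nc_const (a * b) = nc_const a * nc_const b" by (simp add: nc_const_def mult_single)
  show "nc_const (1 :: 'k fps) = 1" by (simp add: nc_const_def)
  show "nc_const a * r = r * nc_const a"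
    by (rule additive_eqI[where f = "\<lambda>r. nc_const a * r"])
       (simp_all add: distrib_left distrib_right nc_const_def mult_single mult.commute)
qed

interpretation pol: central_constants "pconst :: 'k::field \<Rightarrow> 'k pol"
proof
  fix a b :: 'k and r :: "'k pol"
  show "pconst (a + b) = pconst a + pconst b" by (simp add: pconst_def single_add)
  show "pconst (a * b) = pconst a * pconst b" by (simp add: pconst_def mult_single)
  show "pconst (1 :: 'k) = 1" by (simp add: pconst_def)
  show "pconst a * r = r * pconst a" by (rule mult.commute)
qed

interpretation scalar: central_constants "\<lambda>a :: 'k::field. nc_const (fps_const a) :: 'k nc_pol"
proof
  fix a b :: 'k and r :: "'k nc_pol"
  show "nc_const (fps_const (a + b)) = nc_const (fps_const a) + nc_const (fps_const b)"
    by (simp flip: nc.const_add)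
  show "nc_const (fps_const (a * b)) = nc_const (fps_const a) * nc_const (fps_const b)"
    by (simp flip: nc.const_mult)
  show "nc_const (fps_const (1 :: 'k)) = 1" by (simp add: nc.const_one)
  show "nc_const (fps_const a) * r = r * nc_const (fps_const a)" by (rule nc.const_central)
qed

interpretation classical: central_constants "\<lambda>a :: 'k::field fps. pconst (fps_nth a 0) :: 'k pol"
proof
  fix a b :: "'k fps" and r :: "'k pol"
  show "pconst (fps_nth (a + b) 0) = pconst (fps_nth a 0) + pconst (fps_nth b 0)"
    by (simp add: pol.const_add)
  show "pconst (fps_nth (a * b) 0) = pconst (fps_nth a 0) * pconst (fps_nth b 0)"
    by (simp add: pol.const_mult)
  show "pconst (fps_nth (1 :: 'k fps) 0) = 1" by (simp add: pol.const_one)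
  show "pconst (fps_nth a 0) * r = r * pconst (fps_nth a 0)" by (rule mult.commute)
qed

lemma prod_list_nc_var: "prod_list (map nc_var w) = Poly_Mapping.single (Letters w) 1"
  by (induction w) (simp_all add: nc_var_def mult_single plus_free_monoid_def zero_free_monoid_def flip: single_one)

lemma single_eq_const_times_word:
  "Poly_Mapping.single w a = nc_const a * prod_list (map nc_var (letters w))"
  by (cases w) (simp add: prod_list_nc_var nc_const_def mult_single)

text \<open>
  The exponent of the commutative monomial that a word in the letters becomes modulo \<open>\<hbar>\<close>.
\<close>

definition word_exponent :: "3 list \<Rightarrow> (3 \<Rightarrow>\<^sub>0 nat)"
  where "word_exponent w = (\<Sum>i\<leftarrow>w. Poly_Mapping.single i 1)"

lemma prod_list_pvar: "prod_list (map pvar w) = Poly_Mapping.single (word_exponent w) 1"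
  by (induction w) (simp_all add: pvar_def mult_single word_exponent_def flip: single_one)

lemma lookup_word_exponent: "Poly_Mapping.lookup (word_exponent w) i = count (mset w) i"
  by (induction w) (auto simp: word_exponent_def lookup_add lookup_single when_def)

lemma word_exponent_eq_iff: "word_exponent u = word_exponent v \<longleftrightarrow> mset u = mset v"
  by (metis lookup_word_exponent multiset_eqI poly_mapping_eqI)

lemma word_exponent_surj: "\<exists>w. word_exponent w = m"
proof (induction m rule: poly_mapping_additive_induct)
  case zero
  show ?case by (rule exI[of _ "[]"]) (simp add: word_exponent_def)
next
  case (single i n)
  have "word_exponent (replicate n i) = Poly_Mapping.single i n"
    by (induction n) (simp_all add: word_exponent_def flip: single_add)
  then show ?case ..
next
  case (add p q)
  then obtain u v where "word_exponent u = p" "word_exponent v = q" by blast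
  then have "word_exponent (u @ v) = p + q" by (simp add: word_exponent_def)
  then show ?case ..
qed


lemma lookup_pconst_mult: "Poly_Mapping.lookup (pconst a * f) m = a * Poly_Mapping.lookup f m"
  by (rule additive_eqI[where f = "\<lambda>f. Poly_Mapping.lookup (pconst a * f) m"])
     (simp_all add: distrib_left lookup_add pconst_def mult_single lookup_single when_def)


section \<open>Linear substitutions\<close>

definition nc_linear_form :: "(3 \<Rightarrow> 'k::field) \<Rightarrow> 'k nc_pol"
  where "nc_linear_form a = (\<Sum>j\<in>UNIV. nc_const (fps_const (a j)) * nc_var j)"

lemma nc_linear_subst_eq: "nc_linear_subst a = nc.evaluation (\<lambda>i. nc_linear_form (a i))"
  by (simp add: fun_eq_iff nc_linear_subst_def nc.evaluation_def additive_extension_def nc_linear_form_def)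

lemma nc_linear_subst_add: "nc_linear_subst a (p + q) = nc_linear_subst a p + nc_linear_subst a q"
  by (simp add: nc_linear_subst_eq nc.evaluation_add)

lemma nc_linear_subst_mult: "nc_linear_subst a (p * q) = nc_linear_subst a p * nc_linear_subst a q"
  by (simp add: nc_linear_subst_eq nc.evaluation_mult)

lemma nc_linear_subst_const [simp]: "nc_linear_subst a (nc_const s) = nc_const s"
  unfolding nc_linear_subst_eq nc_const_def nc.evaluation_single by (simp add: zero_free_monoid_def nc_const_def)

lemma nc_linear_subst_var [simp]: "nc_linear_subst a (nc_var i) = nc_linear_form (a i)"
  unfolding nc_linear_subst_eq nc_var_def nc.evaluation_single by (simp add: nc.const_one)

lemma nc_linear_subst_zero [simp]: "nc_linear_subst a 0 = 0"
  using nc_linear_subst_add[of a 0 0] by simp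

lemma nc_linear_subst_one [simp]: "nc_linear_subst a 1 = 1"
  using nc_linear_subst_const[of a 1] by (simp add: nc.const_one)

lemma nc_linear_subst_uminus: "nc_linear_subst a (- p) = - nc_linear_subst a p"
  using nc_linear_subst_add[of a p "- p"] by (simp add: eq_neg_iff_add_eq_0 add.commute)

lemma nc_linear_subst_diff: "nc_linear_subst a (p - q) = nc_linear_subst a p - nc_linear_subst a q"
  using nc_linear_subst_add[of a p "- q"] by (simp add: nc_linear_subst_uminus)

lemma nc_linear_subst_sum: "nc_linear_subst a (sum f A) = (\<Sum>x\<in>A. nc_linear_subst a (f x))"
  by (induction A rule: infinite_finite_induct) (simp_all add: nc_linear_subst_add)

lemma nc_linear_subst_prod_list:
  "nc_linear_subst a (prod_list (map f w)) = prod_list (map (\<lambda>i. nc_linear_subst a (f i)) w)"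
  by (induction w) (simp_all add: nc_linear_subst_mult)

lemma nc_linear_subst_single:
  "nc_linear_subst a (Poly_Mapping.single w s) = nc_const s * prod_list (map (\<lambda>i. nc_linear_form (a i)) (letters w))"
  by (simp add: nc_linear_subst_eq nc.evaluation_single)


section \<open>Reduction modulo \<open>\<hbar>\<close>\<close>

definition reduction :: "'k::field nc_pol \<Rightarrow> 'k pol"
  where "reduction = classical.evaluation pvar"

lemma reduction_add: "reduction (p + q) = reduction p + reduction q"
  by (simp add: reduction_def classical.evaluation_add)

lemma reduction_mult: "reduction (p * q) = reduction p * reduction q"
  by (simp add: reduction_def classical.evaluation_mult)

lemma reduction_const [simp]: "reduction (nc_const s) = pconst (fps_nth s 0)"
  unfolding reduction_def nc_const_def classical.evaluation_single by (simp add: zero_free_monoid_def)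

lemma reduction_var [simp]: "reduction (nc_var i) = pvar i"
  unfolding reduction_def nc_var_def classical.evaluation_single by (simp add: pol.const_one)

lemma reduction_zero [simp]: "reduction 0 = 0"
  using reduction_add[of 0 0] by (metis add_0 add_cancel_right_right)

lemma reduction_one [simp]: "reduction 1 = 1"
  using reduction_const[of 1] by (simp add: nc.const_one pol.const_one)

lemma reduction_uminus: "reduction (- p) = - reduction p"
  using reduction_add[of p "- p"] by (simp add: eq_neg_iff_add_eq_0 add.commute)

lemma reduction_diff: "reduction (p - q) = reduction p - reduction q"
  using reduction_add[of p "- q"] by (simp add: reduction_uminus)

lemma reduction_sum: "reduction (sum f A) = (\<Sum>x\<in>A. reduction (f x))"
  by (induction A rule: infinite_finite_induct) (simp_all add: reduction_add)

lemma reduction_word: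
  "reduction (Poly_Mapping.single w s) = pconst (fps_nth s 0) * prod_list (map pvar (letters w))"
  unfolding reduction_def by (rule classical.evaluation_single)

lemma reduction_single:
  "reduction (Poly_Mapping.single w s) = Poly_Mapping.single (word_exponent (letters w)) (fps_nth s 0)"
  unfolding reduction_def classical.evaluation_single prod_list_pvar
  by (simp add: pconst_def mult_single)


section \<open>Ideals, quotients and record selectors\<close>

lemma ring_of_type_algebra_simps [simp]:
  "carrier ring_of_type_algebra = UNIV" "monoid.mult ring_of_type_algebra = (*)"
  "one ring_of_type_algebra = 1" "ring.zero ring_of_type_algebra = 0" "add ring_of_type_algebra = (+)"
  by (simp_all add: ring_of_type_algebra_def)

lemma ring_of_type_algebra_ring: "ring (ring_of_type_algebra :: 'a::ring_1 ring)"
proof -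
  have "\<exists>y. x + y = 0" "\<exists>y. y + x = 0" for x :: 'a
    by (rule exI[of _ "- x"], simp)+
  then show ?thesis
    by unfold_locales (auto simp: algebra_simps Units_def)
qed

text \<open>
  Closure under negation is multiplication by \<open>- 1\<close>.
\<close>

lemma ring_of_type_algebra_idealI:
  fixes J :: "'a::ring_1 set"
  assumes "0 \<in> J" "\<And>x y. x \<in> J \<Longrightarrow> y \<in> J \<Longrightarrow> x + y \<in> J"
    and "\<And>x r. x \<in> J \<Longrightarrow> r * x \<in> J" "\<And>x r. x \<in> J \<Longrightarrow> x * r \<in> J"
  shows "ideal J ring_of_type_algebra"
proof -
  interpret R: ring "ring_of_type_algebra :: 'a ring" by (rule ring_of_type_algebra_ring)
  show ?thesis
  proof (rule idealI[OF R.ring_axioms])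
    have neg: "\<ominus>\<^bsub>ring_of_type_algebra\<^esub> x = - x" for x :: 'a
      by (rule R.minus_equality) simp_all
    have "- x \<in> J" if "x \<in> J" for x using assms(3)[OF that, of "- 1"] by simp
    then show "subgroup J (add_monoid ring_of_type_algebra)"
      using assms(1,2) neg by (intro R.add.subgroupI) (auto simp: a_inv_def)
  qed (use assms(3,4) in auto)
qed

lemma pol_poisson_simps [simp]:
  "carrier (pol_poisson br) = UNIV" "monoid.mult (pol_poisson br) = (*)"
  "one (pol_poisson br) = 1" "ring.zero (pol_poisson br) = 0" "add (pol_poisson br) = (+)"
  "module.smult (pol_poisson br) = (\<lambda>a p. pconst a * p)" "pbracket (pol_poisson br) = br"
  by (simp_all add: pol_poisson_def with_bracket_def pol_algebra_def algebra_via_def module.defs poisson.defs)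

lemma with_bracket_simps [simp]:
  "carrier (with_bracket M B) = carrier M" "monoid.mult (with_bracket M B) = monoid.mult M"
  "one (with_bracket M B) = one M" "ring.zero (with_bracket M B) = ring.zero M" "add (with_bracket M B) = add M"
  "module.smult (with_bracket M B) = module.smult M" "pbracket (with_bracket M B) = B"
  by (simp_all add: with_bracket_def module.defs poisson.defs)

lemma quantization_ideal_ideal: "ideal (quantization_ideal c) ring_of_type_algebra"
  unfolding quantization_ideal_def by (rule ring.genideal_ideal[OF ring_of_type_algebra_ring]) simp

lemma quantization_relation_mem: "quantization_relation c i j \<in> quantization_ideal c"
  using ring.genideal_self[OF ring_of_type_algebra_ring, of "{quantization_relation c i j | i j. True}"]
  unfolding quantization_ideal_def by auto

lemma quantization_ideal_subset:
  assumes "ideal J ring_of_type_algebra" "\<And>i j. quantization_relation c i j \<in> J"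
  shows "quantization_ideal c \<subseteq> J"
  unfolding quantization_ideal_def
  by (rule ring.genideal_minimal[OF ring_of_type_algebra_ring assms(1)]) (use assms(2) in auto)

context
  fixes J :: "'a::ring_1 set"
  assumes J: "ideal J ring_of_type_algebra"
begin

lemma type_ideal_zero: "0 \<in> J"
  using additive_subgroup.zero_closed[OF ideal.axioms(1)[OF J]] by simp

lemma type_ideal_add: "x \<in> J \<Longrightarrow> y \<in> J \<Longrightarrow> x + y \<in> J"
  using additive_subgroup.a_closed[OF ideal.axioms(1)[OF J]] by simp

lemma type_ideal_mult_left: "x \<in> J \<Longrightarrow> r * x \<in> J"
  using ideal.I_l_closed[OF J] by simp

lemma type_ideal_mult_right: "x \<in> J \<Longrightarrow> x * r \<in> J"
  using ideal.I_r_closed[OF J] by simp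

lemma type_ideal_uminus: "x \<in> J \<Longrightarrow> - x \<in> J"
  using type_ideal_mult_left[of x "- 1"] by simp

lemma type_ideal_diff: "x \<in> J \<Longrightarrow> y \<in> J \<Longrightarrow> x - y \<in> J"
  using type_ideal_add[of x "- y"] type_ideal_uminus by simp

lemma type_ideal_sum: "(\<And>x. x \<in> A \<Longrightarrow> f x \<in> J) \<Longrightarrow> sum f A \<in> J"
  by (induction A rule: infinite_finite_induct) (auto intro: type_ideal_zero type_ideal_add)

lemma type_ideal_coset_eq_iff: "J +>\<^bsub>ring_of_type_algebra\<^esub> x = J +>\<^bsub>ring_of_type_algebra\<^esub> y \<longleftrightarrow> x - y \<in> J"
proof -
  have coset: "J +>\<^bsub>ring_of_type_algebra\<^esub> x = {z. z - x \<in> J}" for x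
    by (force simp: a_r_coset_def r_coset_def)
  show ?thesis
  proof
    assume "J +>\<^bsub>ring_of_type_algebra\<^esub> x = J +>\<^bsub>ring_of_type_algebra\<^esub> y"
    then have "x \<in> {z. z - y \<in> J}" using type_ideal_zero unfolding coset by auto
    then show "x - y \<in> J" by simp
  next
    assume xy: "x - y \<in> J"
    have "z - x \<in> J \<longleftrightarrow> z - y \<in> J" for z
      using type_ideal_add[OF _ xy, of "z - x"] type_ideal_diff[OF _ xy, of "z - y"] by auto
    then show "J +>\<^bsub>ring_of_type_algebra\<^esub> x = J +>\<^bsub>ring_of_type_algebra\<^esub> y"
      unfolding coset by simp
  qed
qed

end

lemmas quantization_ideal_zero = type_ideal_zero[OF quantization_ideal_ideal]
  and quantization_ideal_add = type_ideal_add[OF quantization_ideal_ideal]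
  and quantization_ideal_mult_left = type_ideal_mult_left[OF quantization_ideal_ideal]
  and quantization_ideal_mult_right = type_ideal_mult_right[OF quantization_ideal_ideal]
  and quantization_ideal_diff = type_ideal_diff[OF quantization_ideal_ideal]
  and quantization_ideal_sum = type_ideal_sum[OF quantization_ideal_ideal]

lemma quantization_class_eq_iff:
  "quantization_class c p = quantization_class c q \<longleftrightarrow> p - q \<in> quantization_ideal c"
  unfolding quantization_class_def by (rule type_ideal_coset_eq_iff[OF quantization_ideal_ideal])

lemma quantization_class_mem: "p \<in> quantization_class c p"
  using quantization_ideal_zero[of c] by (force simp: quantization_class_def a_r_coset_def r_coset_def)

lemma mem_quantization_class_iff: "q \<in> quantization_class c p \<longleftrightarrow> q - p \<in> quantization_ideal c"
  by (force simp: quantization_class_def a_r_coset_def r_coset_def)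

lemma quantization_class_hom:
  "quantization_class c \<in> ring_hom ring_of_type_algebra (quantization c)"
  using ideal.rcos_ring_hom[OF quantization_ideal_ideal[of c]]
  unfolding quantization_def quantization_class_def[abs_def] by simp

lemma quantization_ring: "ring (quantization c)"
  unfolding quantization_def by (rule ideal.quotient_is_ring[OF quantization_ideal_ideal])

lemma carrier_quantization: "carrier (quantization c) = range (quantization_class c)"
  by (auto simp: quantization_def quantization_class_def FactRing_def A_RCOSETS_def')

lemma quantization_class_mult:
  "quantization_class c p \<otimes>\<^bsub>quantization c\<^esub> quantization_class c q = quantization_class c (p * q)"
  using ring_hom_mult[OF quantization_class_hom, of p q] by simp

lemma quantization_class_add:
  "quantization_class c p \<oplus>\<^bsub>quantization c\<^esub> quantization_class c q = quantization_class c (p + q)"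
  using ring_hom_add[OF quantization_class_hom, of p q] by simp

lemma quantization_class_one: "\<one>\<^bsub>quantization c\<^esub> = quantization_class c 1"
  using ring_hom_one[OF quantization_class_hom, of c] by simp

lemma quantization_class_zero: "\<zero>\<^bsub>quantization c\<^esub> = quantization_class c 0"
  using ring_hom_zero[OF quantization_class_hom ring_of_type_algebra_ring quantization_ring, of c] by simp


section \<open>Kernel of the reduction\<close>

text \<open>
  The ideal \<open>I + \<hbar>F\<close>, which turns out to be the kernel of the reduction.
\<close>

definition quantization_ideal_hbar :: "(3 \<Rightarrow> 3 \<Rightarrow> 3 \<Rightarrow> 3 \<Rightarrow> 'k::field) \<Rightarrow> 'k nc_pol set"
  where "quantization_ideal_hbar c = {r + nc_const fps_X * q | r q. r \<in> quantization_ideal c}"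

lemma quantization_ideal_hbar_ideal: "ideal (quantization_ideal_hbar c) ring_of_type_algebra"
proof (rule ring_of_type_algebra_idealI)
  show "0 \<in> quantization_ideal_hbar c"
    unfolding quantization_ideal_hbar_def using quantization_ideal_zero[of c]
    by (auto intro!: exI[of _ 0])
next
  fix x y assume "x \<in> quantization_ideal_hbar c" "y \<in> quantization_ideal_hbar c"
  then obtain r q r' q' where "x = r + nc_const fps_X * q" "y = r' + nc_const fps_X * q'"
    "r \<in> quantization_ideal c" "r' \<in> quantization_ideal c"
    unfolding quantization_ideal_hbar_def by auto
  moreover from this have "x + y = (r + r') + nc_const fps_X * (q + q')"
    by (simp add: algebra_simps)
  ultimately show "x + y \<in> quantization_ideal_hbar c"
    unfolding quantization_ideal_hbar_def using quantization_ideal_add by blast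
next
  fix x s assume "x \<in> quantization_ideal_hbar c"
  then obtain r q where x: "x = r + nc_const fps_X * q" and r: "r \<in> quantization_ideal c"
    unfolding quantization_ideal_hbar_def by auto
  \<comment> \<open>The constant \<open>\<hbar>\<close> is central, so it can be moved to the front.\<close>
  have "s * x = s * r + nc_const fps_X * (s * q)" "x * s = r * s + nc_const fps_X * (q * s)"
    using nc.const_central[of fps_X s] by (simp_all add: x algebra_simps) (metis mult.assoc)
  then show "s * x \<in> quantization_ideal_hbar c" "x * s \<in> quantization_ideal_hbar c"
    unfolding quantization_ideal_hbar_def
    using quantization_ideal_mult_left[OF r] quantization_ideal_mult_right[OF r] by blast+
qed

lemma hbar_multiple_mem: "nc_const fps_X * q \<in> quantization_ideal_hbar c"
  unfolding quantization_ideal_hbar_def using quantization_ideal_zero[of c] by force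

lemmas quantization_ideal_hbar_closed =
  type_ideal_zero[OF quantization_ideal_hbar_ideal] type_ideal_add[OF quantization_ideal_hbar_ideal]
  type_ideal_mult_left[OF quantization_ideal_hbar_ideal] type_ideal_mult_right[OF quantization_ideal_hbar_ideal]
  type_ideal_diff[OF quantization_ideal_hbar_ideal] type_ideal_uminus[OF quantization_ideal_hbar_ideal]

text \<open>
  The right-hand side of a quantization relation is divisible by \<open>\<hbar>\<close>, so the letters commute modulo
  \<open>I + \<hbar>F\<close>.
\<close>

lemma commutator_mem_hbar:
  "nc_var i * nc_var j - nc_var j * nc_var i \<in> quantization_ideal_hbar c"
proof -
  have "nc_var i * nc_var j - nc_var j * nc_var i = quantization_relation c i j
      + nc_const fps_X * (nc_const (fps_const (1/2)) * (\<Sum>k\<in>UNIV. \<Sum>l\<in>UNIV.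
        nc_const (fps_const (c i j k l)) * (nc_var k * nc_var l + nc_var l * nc_var k)))"
    unfolding quantization_relation_def nc.const_mult by (simp add: mult.assoc)
  then show ?thesis
    using quantization_relation_mem unfolding quantization_ideal_hbar_def by blast
qed

lemma var_commutes_with_word:
  "prod_list (map nc_var w) * nc_var i - nc_var i * prod_list (map nc_var w) \<in> quantization_ideal_hbar c"
proof (induction w)
  case Nil
  show ?case by (simp add: quantization_ideal_hbar_closed)
next
  case (Cons j w)
  let ?w = "prod_list (map nc_var w)"
  have eq: "prod_list (map nc_var (j # w)) * nc_var i - nc_var i * prod_list (map nc_var (j # w))
    = nc_var j * (?w * nc_var i - nc_var i * ?w) + (nc_var j * nc_var i - nc_var i * nc_var j) * ?w"
    by (simp add: algebra_simps)
  show ?case unfolding eq by (intro quantization_ideal_hbar_closed Cons.IH commutator_mem_hbar)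
qed

text \<open>
  By induction: the first letter of \<open>u\<close> occurs in \<open>v\<close>, where it can be moved to the front.
\<close>

lemma permuted_words_congruent:
  assumes "mset u = mset v"
  shows "prod_list (map nc_var u) - prod_list (map nc_var v) \<in> quantization_ideal_hbar c"
  using assms
proof (induction u arbitrary: v)
  case Nil
  then show ?case by (simp add: quantization_ideal_hbar_closed)
next
  case (Cons i u)
  then have "i \<in> set v" by (metis list.set_intros(1) set_mset_mset)
  then obtain v1 v2 where v: "v = v1 @ i # v2" by (auto simp: in_set_conv_decomp)
  let ?y = "\<lambda>w. prod_list (map nc_var w)"
  have eq: "?y (i # u) - ?y v
    = nc_var i * (?y u - ?y (v1 @ v2)) - (?y v1 * nc_var i - nc_var i * ?y v1) * ?y v2"
    by (simp add: v algebra_simps)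
  show ?case
    unfolding eq using Cons.prems
    by (intro quantization_ideal_hbar_closed Cons.IH var_commutes_with_word) (simp add: v)
qed

text \<open>
  A \<open>k\<close>-linear section of the reduction. Words with the same exponent agree modulo \<open>I + \<hbar>F\<close>, so an
  arbitrary one may represent each monomial.
\<close>

definition ordered_lift :: "'k::field pol \<Rightarrow> 'k nc_pol"
  where "ordered_lift = additive_extension (\<lambda>m a. nc_const (fps_const a)
    * prod_list (map nc_var (SOME w. word_exponent w = m)))"

lemma ordered_lift_add: "ordered_lift (p + q) = ordered_lift p + ordered_lift q"
  unfolding ordered_lift_def
  by (rule additive_extension_add) (simp_all add: nc.const_zero nc.const_add distrib_right flip: fps_const_add)

lemma ordered_lift_single:
  "ordered_lift (Poly_Mapping.single m a)
    = nc_const (fps_const a) * prod_list (map nc_var (SOME w. word_exponent w = m))"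
  unfolding ordered_lift_def by (rule additive_extension_single) (simp add: nc.const_zero)

lemma lift_exponent: "word_exponent (SOME w. word_exponent w = m) = m"
  by (rule someI_ex[OF word_exponent_surj])

lemma reduction_ordered_lift [simp]: "reduction (ordered_lift f) = f"
proof (induction f rule: poly_mapping_additive_induct)
  case zero
  show ?case by (simp add: ordered_lift_def additive_extension_def)
next
  case (single m a)
  show ?case
    by (simp add: ordered_lift_single prod_list_nc_var reduction_mult reduction_single lift_exponent pconst_def mult_single)
next
  case (add p q)
  then show ?case by (simp add: ordered_lift_add reduction_add)
qed

text \<open>
  For a word with coefficient \<open>s \<in> k[[\<hbar>]]\<close>, the difference is \<open>s - s\<^sub>0 \<in> (\<hbar>)\<close> times the word, plus \<open>s\<^sub>0\<close> times
  the difference of two words that are permutations of each other.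
\<close>

lemma congruent_ordered_lift_reduction: "p - ordered_lift (reduction p) \<in> quantization_ideal_hbar c"
proof (induction p rule: poly_mapping_additive_induct)
  case zero
  show ?case by (simp add: ordered_lift_def additive_extension_def quantization_ideal_hbar_closed)
next
  case (single w s)
  let ?m = "word_exponent (letters w)"
  define w' where "w' = (SOME w. word_exponent w = ?m)"
  have "mset (letters w) = mset w'"
    unfolding w'_def by (metis lift_exponent word_exponent_eq_iff)
  then have perm: "prod_list (map nc_var (letters w)) - prod_list (map nc_var w') \<in> quantization_ideal_hbar c"
    by (rule permuted_words_congruent)
  have s: "s = fps_X * fps_shift 1 s + fps_const (fps_nth s 0)"
    by (rule fps_ext) auto
  have "nc_const s = nc_const fps_X * nc_const (fps_shift 1 s) + nc_const (fps_const (fps_nth s 0))"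
    by (subst s) (simp only: nc.const_add nc.const_mult)
  then have "Poly_Mapping.single w s
    = nc_const fps_X * (nc_const (fps_shift 1 s) * prod_list (map nc_var (letters w)))
      + nc_const (fps_const (fps_nth s 0)) * prod_list (map nc_var (letters w))"
    unfolding single_eq_const_times_word[of w s] by (simp only: distrib_right mult.assoc)
  moreover have "ordered_lift (reduction (Poly_Mapping.single w s))
    = nc_const (fps_const (fps_nth s 0)) * prod_list (map nc_var w')"
    by (simp add: reduction_single ordered_lift_single w'_def)
  ultimately have eq: "Poly_Mapping.single w s - ordered_lift (reduction (Poly_Mapping.single w s))
    = nc_const fps_X * (nc_const (fps_shift 1 s) * prod_list (map nc_var (letters w)))
      + nc_const (fps_const (fps_nth s 0)) * (prod_list (map nc_var (letters w)) - prod_list (map nc_var w'))"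
    by (simp only: right_diff_distrib add_diff_eq)
  show ?case
    unfolding eq by (intro quantization_ideal_hbar_closed perm hbar_multiple_mem)
next
  case (add p q)
  have eq: "p + q - ordered_lift (reduction (p + q)) = (p - ordered_lift (reduction p)) + (q - ordered_lift (reduction q))"
    by (simp add: reduction_add ordered_lift_add)
  show ?case unfolding eq by (intro quantization_ideal_hbar_closed add.IH)
qed

lemma reduction_eq_zeroD:
  assumes "reduction p = 0"
  obtains r q where "r \<in> quantization_ideal c" "p = r + nc_const fps_X * q"
proof -
  have "ordered_lift 0 = (0 :: 'a nc_pol)" by (simp add: ordered_lift_def additive_extension_def)
  then show ?thesis
    using congruent_ordered_lift_reduction[of p c] assms that
    by (auto simp: quantization_ideal_hbar_def)
qed

lemma reduction_quantization_relation [simp]: "reduction (quantization_relation c i j) = 0"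
  by (simp add: quantization_relation_def reduction_diff reduction_mult nc.const_mult pol.const_zero mult.commute)


section \<open>The star product modulo \<open>\<hbar>\<^sup>2\<close>\<close>

text \<open>
  The coefficient of \<open>\<hbar>\<close> in \<open>x\<^bsub>i\<^sub>1\<^esub> \<star> \<dots> \<star> x\<^bsub>i\<^sub>n\<^esub>\<close>, where \<open>f \<star> g = f g + (\<hbar>/2) {f, g}\<close> modulo \<open>\<hbar>\<^sup>2\<close>.
\<close>

primrec word_bracket :: "('k::field pol \<Rightarrow> 'k pol \<Rightarrow> 'k pol) \<Rightarrow> 3 list \<Rightarrow> 'k pol"
  where
    "word_bracket br [] = 0"
  | "word_bracket br (i # w) = pvar i * word_bracket br w
      + pconst (1 / 2) * br (pvar i) (prod_list (map pvar w))"

text \<open>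
  The coefficient of \<open>\<hbar>\<close> of the image in \<open>P \<oplus> \<hbar>P\<close>. It has a second summand because the coefficients of a
  noncommutative polynomial contain \<open>\<hbar>\<close> themselves.
\<close>

definition first_order :: "('k::field pol \<Rightarrow> 'k pol \<Rightarrow> 'k pol) \<Rightarrow> 'k nc_pol \<Rightarrow> 'k pol"
  where "first_order br = additive_extension (\<lambda>w a. pconst (fps_nth a 0) * word_bracket br (letters w)
    + pconst (fps_nth a 1) * prod_list (map pvar (letters w)))"

lemma first_order_add: "first_order br (p + q) = first_order br p + first_order br q"
  unfolding first_order_def
  by (rule additive_extension_add) (simp_all add: pol.const_zero pol.const_add algebra_simps)

lemma first_order_single:
  "first_order br (Poly_Mapping.single w a) = pconst (fps_nth a 0) * word_bracket br (letters w)
    + pconst (fps_nth a 1) * prod_list (map pvar (letters w))"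
  unfolding first_order_def by (rule additive_extension_single) (simp add: pol.const_zero)

lemma first_order_zero [simp]: "first_order br 0 = 0"
  by (simp add: first_order_def additive_extension_def)

lemma first_order_diff: "first_order br (p - q) = first_order br p - first_order br q"
  using first_order_add[of br "p - q" q] by simp

lemma first_order_const [simp]: "first_order br (nc_const a) = pconst (fps_nth a 1)"
  unfolding nc_const_def first_order_single by (simp add: zero_free_monoid_def)

locale quantized_bracket =
  fixes br :: "'k::field_char_0 pol \<Rightarrow> 'k pol \<Rightarrow> 'k pol"
    and c :: "3 \<Rightarrow> 3 \<Rightarrow> 3 \<Rightarrow> 3 \<Rightarrow> 'k"
  assumes poisson: "poisson_algebra ring_of_type_algebra (pol_poisson br)"
    and structure_constants: "br (pvar i) (pvar j) =
      (\<Sum>k\<in>UNIV. \<Sum>l\<in>UNIV. pconst (c i j k l) * (pvar k * pvar l))"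
begin

lemma br_add_left: "br (x + y) z = br x z + br y z"
  using poisson_algebra.bracket_add_l[OF poisson, of x y z] by simp

lemma br_add_right: "br x (y + z) = br x y + br x z"
  using poisson_algebra.bracket_add_r[OF poisson, of x y z] by simp

lemma br_const_left: "br (pconst a * x) y = pconst a * br x y"
  using poisson_algebra.bracket_smult_l[OF poisson, of a x y] by simp

lemma br_const_right: "br x (pconst a * y) = pconst a * br x y"
  using poisson_algebra.bracket_smult_r[OF poisson, of a x y] by simp

lemma br_self: "br x x = 0"
  using poisson_algebra.bracket_self[OF poisson, of x] by simp

lemma br_leibniz_right: "br x (y * z) = y * br x z + br x y * z"
  using poisson_algebra.bracket_leibniz[OF poisson, of x y z] by simp

lemma br_zero_left [simp]: "br 0 y = 0"
  using br_add_left[of 0 0 y] by (metis add_0 add_cancel_right_right)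

lemma br_zero_right [simp]: "br x 0 = 0"
  using br_add_right[of x 0 0] by (metis add_0 add_cancel_right_right)

lemma br_antisym: "br y x = - br x y"
proof -
  have "br (x + y) (x + y) = br x y + br y x"
    by (subst br_add_left) (simp only: br_add_right br_self add_0_left add_0_right)
  then have "br y x + br x y = 0" by (metis br_self add.commute)
  then show ?thesis by (simp only: eq_neg_iff_add_eq_0)
qed

lemma br_leibniz_left: "br (x * y) z = x * br y z + br x z * y"
proof -
  have "br (x * y) z = - (x * br z y + br z x * y)"
    by (subst br_antisym) (simp only: br_leibniz_right)
  also have "\<dots> = x * br y z + br x z * y"
    by (simp add: br_antisym[of z x] br_antisym[of z y])
  finally show ?thesis .
qed

lemma br_one_right [simp]: "br x 1 = 0"
  using br_leibniz_right[of x 1 1] by simp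

lemma br_one_left [simp]: "br 1 x = 0"
  using br_leibniz_left[of 1 1 x] by simp

lemma half_add_half: "pconst (1 / 2) * x + pconst (1 / 2) * x = (x :: 'k pol)"
proof -
  have "pconst (1 / 2) + pconst (1 / 2) = (1 :: 'k pol)"
    by (simp add: pol.const_one flip: pol.const_add)
  then show ?thesis by (simp only: distrib_right[symmetric] mult_1_left)
qed

text \<open>
  This is associativity of the star product modulo \<open>\<hbar>\<^sup>2\<close>: concatenation of words goes to the star product.
  The Leibniz rule in both arguments is what moves a letter through the bracket.
\<close>

lemma word_bracket_append:
  "word_bracket br (u @ w) = word_bracket br u * prod_list (map pvar w)
    + prod_list (map pvar u) * word_bracket br w
    + pconst (1 / 2) * br (prod_list (map pvar u)) (prod_list (map pvar w))"
  by (induction u) (simp_all add: br_leibniz_left br_leibniz_right algebra_simps)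

lemma first_order_var [simp]: "first_order br (nc_var i) = 0"
  unfolding nc_var_def first_order_single by (simp add: pol.const_zero)

text \<open>
  Together with multiplicativity of the reduction, this says that \<open>p \<mapsto> reduction p + \<hbar> first_order p\<close> is
  multiplicative for the star product.
\<close>

lemma first_order_mult:
  "first_order br (p * q) = first_order br p * reduction q + reduction p * first_order br q
    + pconst (1 / 2) * br (reduction p) (reduction q)"
proof (rule biadditive_eqI[where f = "\<lambda>p q. first_order br (p * q)"])
  fix w a u b
  show "first_order br (Poly_Mapping.single w a * Poly_Mapping.single u b)
    = first_order br (Poly_Mapping.single w a) * reduction (Poly_Mapping.single u b)
    + reduction (Poly_Mapping.single w a) * first_order br (Poly_Mapping.single u b)
    + pconst (1 / 2) * br (reduction (Poly_Mapping.single w a)) (reduction (Poly_Mapping.single u b))"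
    unfolding mult_single first_order_single reduction_def classical.evaluation_single
    by (simp add: plus_free_monoid_def word_bracket_append br_const_left br_const_right
        pol.const_add pol.const_mult algebra_simps)
qed (simp_all add: first_order_add reduction_add br_add_left br_add_right algebra_simps)

lemma first_order_hbar: "first_order br (nc_const fps_X * r) = reduction r"
  by (simp add: first_order_mult pol.const_zero pol.const_one)

lemma first_order_commutator:
  "first_order br (p * q - q * p) = br (reduction p) (reduction q)"
proof -
  show ?thesis
    using br_antisym[of "reduction q" "reduction p"] half_add_half[of "br (reduction p) (reduction q)"]
    by (simp add: first_order_diff first_order_mult algebra_simps)
qed

text \<open>
  The right-hand side of the relation has \<open>\<hbar>\<close>-coefficient \<open>\<Sum> c\<^sub>i\<^sub>j\<^sup>k\<^sup>l x\<^sub>k x\<^sub>l = {x\<^sub>i, x\<^sub>j}\<close>, which is also that of the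
  commutator of \<open>y\<^sub>i\<close> and \<open>y\<^sub>j\<close>.
\<close>

lemma first_order_quantization_relation: "first_order br (quantization_relation c i j) = 0"
proof -
  let ?S = "\<Sum>k\<in>UNIV. \<Sum>l\<in>UNIV. nc_const (fps_const (c i j k l)) * (nc_var k * nc_var l + nc_var l * nc_var k)"
  have "reduction ?S = br (pvar i) (pvar j) + br (pvar i) (pvar j)"
    by (simp add: structure_constants reduction_sum reduction_mult reduction_add distrib_left
        mult.commute flip: sum.distrib)
  then have "first_order br (nc_const fps_X * (nc_const (fps_const (1 / 2)) * ?S)) = br (pvar i) (pvar j)"
    unfolding first_order_hbar reduction_mult by (simp only: reduction_const fps_nth_fps_const if_True simp_thms distrib_left half_add_half)
  then show ?thesis
    unfolding quantization_relation_def nc.const_mult mult.assoc first_order_diff[of _ "_ - _"] first_order_commutator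
    by simp
qed

lemma quantization_ideal_first_order:
  assumes "p \<in> quantization_ideal c"
  shows "reduction p = 0" "first_order br p = 0"
proof -
  have "ideal {p. reduction p = 0 \<and> first_order br p = 0} ring_of_type_algebra"
    by (rule ring_of_type_algebra_idealI)
       (simp_all add: reduction_add reduction_mult first_order_add first_order_mult)
  then have "quantization_ideal c \<subseteq> {p. reduction p = 0 \<and> first_order br p = 0}"
    by (rule quantization_ideal_subset) (simp add: first_order_quantization_relation)
  with assms show "reduction p = 0" "first_order br p = 0" by auto
qed

text \<open>
  The element \<open>r\<close> is determined modulo \<open>I\<close> only up to \<open>\<hbar>\<close>-torsion. Torsion does not affect its
  reduction, because the first order part recovers the reduction of \<open>r\<close> from \<open>\<hbar> r\<close>.
\<close>

lemma reduction_commutator_quotient: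
  assumes "p * q - q * p - nc_const fps_X * r \<in> quantization_ideal c"
  shows "reduction r = br (reduction p) (reduction q)"
  using quantization_ideal_first_order(2)[OF assms]
  unfolding first_order_diff[of _ "_ - _"] first_order_commutator first_order_hbar by simp

lemma reduction_cong:
  assumes "p - q \<in> quantization_ideal c"
  shows "reduction p = reduction q"
  using quantization_ideal_first_order(1)[OF assms] by (simp add: reduction_diff)

end


section \<open>Graded Poisson automorphisms\<close>

text \<open>
  Structure constants are determined by the bracket only up to antisymmetric matrices. The
  quantization relations do not see the ambiguity, as they pair the constants with the symmetric
  expressions \<open>y\<^sub>k y\<^sub>l + y\<^sub>l y\<^sub>k\<close>.
\<close>

lemma quadratic_form_eq_zeroD:
  fixes d :: "3 \<Rightarrow> 3 \<Rightarrow> 'k::field"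
  assumes "(\<Sum>k\<in>UNIV. \<Sum>l\<in>UNIV. pconst (d k l) * (pvar k * pvar l)) = 0"
  shows "d k l + d l k = 0"
proof -
  let ?m = "Poly_Mapping.single k 1 + Poly_Mapping.single l (1::nat)"
  \<comment> \<open>A monomial \<open>x\<^sub>k x\<^sub>l\<close> determines the multiset of its two variables.\<close>
  have split: "Poly_Mapping.single k' 1 + Poly_Mapping.single l' (1::nat) = ?m
      \<longleftrightarrow> k' = k \<and> l' = l \<or> k' = l \<and> l' = k" for k' l' :: 3
    using word_exponent_eq_iff[of "[k', l']" "[k, l]"]
    by (auto simp: word_exponent_def add_eq_conv_diff)
  have "0 = Poly_Mapping.lookup (\<Sum>k'\<in>UNIV. \<Sum>l'\<in>UNIV. pconst (d k' l') * (pvar k' * pvar l')) ?m"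
    by (simp add: assms)
  also have "\<dots> = (\<Sum>k'\<in>UNIV. \<Sum>l'\<in>UNIV. if k' = k \<and> l' = l \<or> k' = l \<and> l' = k then d k' l' else 0)"
    by (simp add: lookup_sum pconst_def pvar_def mult_single lookup_single when_def split[unfolded One_nat_def])
  also have "\<dots> = (\<Sum>z\<in>UNIV. if z = (k, l) \<or> z = (l, k) then d (fst z) (snd z) else 0)"
    by (simp add: sum.cartesian_product case_prod_beta prod_eq_iff flip: UNIV_Times_UNIV)
  also have "\<dots> = (\<Sum>z\<in>{(k, l), (l, k)}. d (fst z) (snd z))"
    by (rule sum.mono_neutral_cong_right) auto
  finally show ?thesis by (cases "k = l") auto
qed

text \<open>
  A homogeneous linear polynomial is a linear combination of the variables, so that the matrix of a
  graded automorphism determines it.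
\<close>

lemma linear_pol_eq:
  assumes "f \<in> pol_part 1"
  shows "f = (\<Sum>j\<in>UNIV. pconst (Poly_Mapping.lookup f (Poly_Mapping.single j 1)) * pvar j)"
proof (rule poly_mapping_eqI)
  fix m
  have rhs: "Poly_Mapping.lookup (\<Sum>j\<in>UNIV. pconst (Poly_Mapping.lookup f (Poly_Mapping.single j 1)) * pvar j) m
    = (\<Sum>j\<in>UNIV. if Poly_Mapping.single j 1 = m then Poly_Mapping.lookup f m else 0)"
    by (auto simp: lookup_sum pconst_def pvar_def mult_single lookup_single when_def intro!: sum.cong)
  show "Poly_Mapping.lookup f m
    = Poly_Mapping.lookup (\<Sum>j\<in>UNIV. pconst (Poly_Mapping.lookup f (Poly_Mapping.single j 1)) * pvar j) m"
  proof (cases "\<exists>j. m = Poly_Mapping.single j 1")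
    case True
    then obtain j where m: "m = Poly_Mapping.single j 1" by blast
    have "Poly_Mapping.single i 1 = m \<longleftrightarrow> i = j" for i
      using m by (metis lookup_single_eq lookup_single_not_eq zero_neq_one)
    then show ?thesis unfolding rhs by simp
  next
    case False
    have "Poly_Mapping.lookup f m = 0"
    proof (rule ccontr)
      assume "Poly_Mapping.lookup f m \<noteq> 0"
      then have "mon_degree m = 1" using assms by (auto simp: pol_part_def in_keys_iff)
      then obtain j where "Poly_Mapping.lookup m j = 1" "\<And>i. i \<noteq> j \<Longrightarrow> Poly_Mapping.lookup m i = 0"
        unfolding mon_degree_def using sum_eq_1_iff[of UNIV "Poly_Mapping.lookup m"] by auto
      then have "m = Poly_Mapping.single j 1"
        by (intro poly_mapping_eqI) (auto simp: lookup_single when_def)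
      with False show False by blast
    qed
    with False show ?thesis unfolding rhs by (auto intro!: sum.neutral)
  qed
qed

lemma pvar_pol_part: "pvar i \<in> pol_part 1"
  by (simp add: pvar_def pol_part_def mon_degree_def lookup_single when_def)

locale graded_poisson_automorphism = quantized_bracket br c
  for br :: "'k::field_char_0 pol \<Rightarrow> 'k pol \<Rightarrow> 'k pol" and c :: "3 \<Rightarrow> 3 \<Rightarrow> 3 \<Rightarrow> 3 \<Rightarrow> 'k" +
  fixes \<phi> :: "'k pol \<Rightarrow> 'k pol"
  assumes automorphism: "\<phi> \<in> carrier (graded_poisson_Aut br)"
begin

lemma aut_hom: "\<phi> \<in> ring_hom (pol_poisson br) (pol_poisson br)" and aut_bij: "bij \<phi>"
  using automorphism
  by (simp_all add: graded_poisson_Aut_def poisson_iso_def algebra_iso_def ring_iso_def)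

lemma aut_add: "\<phi> (p + q) = \<phi> p + \<phi> q"
  using ring_hom_add[OF aut_hom, of p q] by simp

lemma aut_mult: "\<phi> (p * q) = \<phi> p * \<phi> q"
  using ring_hom_mult[OF aut_hom, of p q] by simp

lemma aut_one: "\<phi> 1 = 1"
  using ring_hom_one[OF aut_hom] by simp

lemma aut_const_mult: "\<phi> (pconst a * p) = pconst a * \<phi> p"
  using automorphism by (simp add: graded_poisson_Aut_def poisson_iso_def algebra_iso_def)

lemma aut_bracket: "\<phi> (br p q) = br (\<phi> p) (\<phi> q)"
  using automorphism by (simp add: graded_poisson_Aut_def poisson_iso_def)

lemma aut_zero: "\<phi> 0 = 0"
  using aut_add[of 0 0] by (metis add_0 add_cancel_right_right)

lemma aut_const: "\<phi> (pconst a) = pconst a"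
  using aut_const_mult[of a 1] by (simp add: aut_one)

lemma aut_sum: "\<phi> (sum f A) = (\<Sum>x\<in>A. \<phi> (f x))"
  by (induction A rule: infinite_finite_induct) (simp_all add: aut_zero aut_add)

lemma aut_var: "\<phi> (pvar i) = (\<Sum>j\<in>UNIV. pconst (linear_matrix \<phi> i j) * pvar j)"
proof -
  have "\<phi> (pvar i) \<in> pol_part 1"
    using automorphism pvar_pol_part by (auto simp: graded_poisson_Aut_def)
  then show ?thesis unfolding linear_matrix_def by (rule linear_pol_eq)
qed

lemma reduction_nc_linear_form: "reduction (nc_linear_form (linear_matrix \<phi> i)) = \<phi> (pvar i)"
  by (simp add: nc_linear_form_def aut_var reduction_sum reduction_mult)

lemma reduction_nc_linear_subst: "reduction (nc_linear_subst (linear_matrix \<phi>) p) = \<phi> (reduction p)"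
proof (rule additive_eqI[where f = "\<lambda>p. reduction (nc_linear_subst (linear_matrix \<phi>) p)"])
  fix w :: "3 free_monoid" and s :: "'k fps"
  have "reduction (prod_list (map (\<lambda>i. nc_linear_form (linear_matrix \<phi> i)) u)) = \<phi> (prod_list (map pvar u))" for u
    by (induction u) (simp_all add: reduction_mult reduction_nc_linear_form aut_mult aut_one)
  then show "reduction (nc_linear_subst (linear_matrix \<phi>) (Poly_Mapping.single w s))
    = \<phi> (reduction (Poly_Mapping.single w s))"
    unfolding nc_linear_subst_single reduction_mult reduction_const reduction_word aut_const_mult
    by simp
qed (simp_all add: nc_linear_subst_add reduction_add aut_add)

text \<open>
  Expanding \<open>\<phi> {x\<^sub>i, x\<^sub>j}\<close> and \<open>{\<phi> x\<^sub>i, \<phi> x\<^sub>j}\<close> into products \<open>x\<^sub>p x\<^sub>q\<close> gives the first and the second sum as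
  coefficients. As \<open>\<phi>\<close> preserves the bracket, their difference is a representation of \<open>0\<close>.
\<close>

lemma structure_constants_equivariant:
  fixes i j
  defines "a \<equiv> linear_matrix \<phi>"
  defines "d \<equiv> \<lambda>p q. (\<Sum>k\<in>UNIV. \<Sum>l\<in>UNIV. c i j k l * (a k p * a l q))
    - (\<Sum>k\<in>UNIV. \<Sum>l\<in>UNIV. a i k * a j l * c k l p q)"
  shows "d p q + d q p = 0"
proof (rule quadratic_form_eq_zeroD)
  have "\<phi> (br (pvar i) (pvar j))
    = (\<Sum>k\<in>UNIV. \<Sum>l\<in>UNIV. pconst (c i j k l) * (\<phi> (pvar k) * \<phi> (pvar l)))"
    by (simp add: structure_constants aut_sum aut_const aut_mult)
  also have "\<dots> = (\<Sum>p\<in>UNIV. \<Sum>q\<in>UNIV. pconst (\<Sum>k\<in>UNIV. \<Sum>l\<in>UNIV. c i j k l * (a k p * a l q)) * (pvar p * pvar q))"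
    unfolding aut_var a_def by (rule pol.substituted_quadratic_form)
  finally have 1: "\<phi> (br (pvar i) (pvar j)) = \<dots>" .
  have br_sum_left: "br (sum f A) y = (\<Sum>x\<in>A. br (f x) y)" for f :: "3 \<Rightarrow> 'k pol" and A y
    by (induction A rule: infinite_finite_induct) (simp_all add: br_add_left)
  have br_sum_right: "br y (sum f A) = (\<Sum>x\<in>A. br y (f x))" for f :: "3 \<Rightarrow> 'k pol" and A y
    by (induction A rule: infinite_finite_induct) (simp_all add: br_add_right)
  have "br (\<phi> (pvar i)) (\<phi> (pvar j))
    = (\<Sum>k\<in>UNIV. \<Sum>l\<in>UNIV. pconst (a i k * a j l) * br (pvar k) (pvar l))"
    unfolding aut_var a_def
    by (subst br_sum_left, intro sum.cong refl, subst br_sum_right, intro sum.cong refl)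
       (simp add: br_const_left br_const_right pol.const_mult mult.assoc mult.left_commute)
  also have "\<dots> = (\<Sum>k\<in>UNIV. \<Sum>l\<in>UNIV. \<Sum>p\<in>UNIV. \<Sum>q\<in>UNIV. pconst (a i k * a j l * c k l p q) * (pvar p * pvar q))"
    by (simp add: structure_constants sum_distrib_left pol.const_mult mult.assoc)
  also have "\<dots> = (\<Sum>p\<in>UNIV. \<Sum>q\<in>UNIV. pconst (\<Sum>k\<in>UNIV. \<Sum>l\<in>UNIV. a i k * a j l * c k l p q) * (pvar p * pvar q))"
    unfolding pol.const_sum sum_distrib_right by (rule sum_swap_pairs)
  finally have 2: "br (\<phi> (pvar i)) (\<phi> (pvar j)) = \<dots>" .
  show "(\<Sum>p\<in>UNIV. \<Sum>q\<in>UNIV. pconst (d p q) * (pvar p * pvar q)) = 0"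
    using 1 2 aut_bracket[of "pvar i" "pvar j"]
    by (simp add: d_def pol.const_diff left_diff_distrib sum_subtractf)
qed

text \<open>
  The commutator of two linear forms expands into commutators of letters. The symmetrised right-hand
  side expands into the coefficients \<open>e\<close> of \<open>\<phi> {x\<^sub>i, x\<^sub>j}\<close>, whereas the relations on the right of the claim
  contribute the coefficients \<open>e'\<close> of \<open>{\<phi> x\<^sub>i, \<phi> x\<^sub>j}\<close>. Since \<open>e - e'\<close> is antisymmetric, the two agree
  after symmetrisation.
\<close>

lemma nc_linear_subst_quantization_relation:
  fixes i j
  defines "a \<equiv> linear_matrix \<phi>"
  shows "nc_linear_subst a (quantization_relation c i j)
    = (\<Sum>p\<in>UNIV. \<Sum>q\<in>UNIV. nc_const (fps_const (a i p * a j q)) * quantization_relation c p q)"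
proof -
  define \<kappa> where "\<kappa> = (\<lambda>x :: 'k. nc_const (fps_const x) :: 'k nc_pol)"
  define Y :: "3 \<Rightarrow> 3 \<Rightarrow> 'k nc_pol" where "Y = (\<lambda>p q. nc_var p * nc_var q + nc_var q * nc_var p)"
  define t :: "'k nc_pol" where "t = nc_const (fps_X * fps_const (1 / 2))"
  define e where "e = (\<lambda>p q. \<Sum>k\<in>UNIV. \<Sum>l\<in>UNIV. c i j k l * (a k p * a l q))"
  define e' where "e' = (\<lambda>p q. \<Sum>k\<in>UNIV. \<Sum>l\<in>UNIV. a i k * a j l * c k l p q)"
  have t_left: "x * (t * y) = t * (x * y)" for x y
    unfolding t_def by (metis nc.const_central mult.assoc)
  have rel: "quantization_relation c p q = (nc_var p * nc_var q - nc_var q * nc_var p)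
      - t * (\<Sum>k\<in>UNIV. \<Sum>l\<in>UNIV. \<kappa> (c p q k l) * Y k l)" for p q
    by (simp add: quantization_relation_def t_def \<kappa>_def Y_def)
  have form: "nc_linear_form (a k) * nc_linear_form (a l)
      = (\<Sum>p\<in>UNIV. \<Sum>q\<in>UNIV. \<kappa> (a k p * a l q) * (nc_var p * nc_var q))" for k l
    unfolding nc_linear_form_def \<kappa>_def by (rule scalar.linear_form_product)
  have form': "nc_linear_form (a l) * nc_linear_form (a k)
      = (\<Sum>p\<in>UNIV. \<Sum>q\<in>UNIV. \<kappa> (a k p * a l q) * (nc_var q * nc_var p))" for k l
    unfolding form by (subst sum.swap) (simp add: mult.commute)
  have comm: "nc_linear_form (a i) * nc_linear_form (a j) - nc_linear_form (a j) * nc_linear_form (a i)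
      = (\<Sum>p\<in>UNIV. \<Sum>q\<in>UNIV. \<kappa> (a i p * a j q) * (nc_var p * nc_var q - nc_var q * nc_var p))"
    unfolding form[of i j] form'[of j i] by (simp add: right_diff_distrib sum_subtractf)
  have sym: "nc_linear_form (a k) * nc_linear_form (a l) + nc_linear_form (a l) * nc_linear_form (a k)
      = (\<Sum>p\<in>UNIV. \<Sum>q\<in>UNIV. \<kappa> (a k p * a l q) * Y p q)" for k l
    unfolding form[of k l] form'[of l k] by (simp add: Y_def distrib_left sum.distrib)
  have absorb: "\<kappa> x * (\<Sum>k\<in>UNIV. \<Sum>l\<in>UNIV. \<kappa> (f k l) * Y k l) = (\<Sum>k\<in>UNIV. \<Sum>l\<in>UNIV. \<kappa> (x * f k l) * Y k l)"
    for x f by (simp add: \<kappa>_def sum_distrib_left scalar.const_mult mult.assoc)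
  have "(\<Sum>k\<in>UNIV. \<Sum>l\<in>UNIV. \<kappa> (c i j k l) * (\<Sum>p\<in>UNIV. \<Sum>q\<in>UNIV. \<kappa> (a k p * a l q) * Y p q))
    = (\<Sum>k\<in>UNIV. \<Sum>l\<in>UNIV. \<Sum>p\<in>UNIV. \<Sum>q\<in>UNIV. \<kappa> (c i j k l * (a k p * a l q)) * Y p q)"
    by (simp only: absorb)
  also have "\<dots> = (\<Sum>p\<in>UNIV. \<Sum>q\<in>UNIV. \<Sum>k\<in>UNIV. \<Sum>l\<in>UNIV. \<kappa> (c i j k l * (a k p * a l q)) * Y p q)"
    by (rule sum_swap_pairs)
  also have "\<dots> = (\<Sum>p\<in>UNIV. \<Sum>q\<in>UNIV. \<kappa> (e p q) * Y p q)"
    by (simp add: e_def \<kappa>_def scalar.const_sum sum_distrib_right)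
  finally have E: "(\<Sum>k\<in>UNIV. \<Sum>l\<in>UNIV. \<kappa> (c i j k l) * (\<Sum>p\<in>UNIV. \<Sum>q\<in>UNIV. \<kappa> (a k p * a l q) * Y p q)) = \<dots>" .
  have "(\<Sum>p\<in>UNIV. \<Sum>q\<in>UNIV. \<kappa> (a i p * a j q) * (t * (\<Sum>k\<in>UNIV. \<Sum>l\<in>UNIV. \<kappa> (c p q k l) * Y k l)))
    = t * (\<Sum>p\<in>UNIV. \<Sum>q\<in>UNIV. \<Sum>k\<in>UNIV. \<Sum>l\<in>UNIV. \<kappa> (a i p * a j q * c p q k l) * Y k l)"
    by (simp only: t_left sum_distrib_left[symmetric] absorb)
  also have "\<dots> = t * (\<Sum>k\<in>UNIV. \<Sum>l\<in>UNIV. \<Sum>p\<in>UNIV. \<Sum>q\<in>UNIV. \<kappa> (a i p * a j q * c p q k l) * Y k l)"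
    by (rule arg_cong, rule sum_swap_pairs)
  also have "\<dots> = t * (\<Sum>k\<in>UNIV. \<Sum>l\<in>UNIV. \<kappa> (e' k l) * Y k l)"
    by (simp add: e'_def \<kappa>_def scalar.const_sum sum_distrib_right)
  finally have E': "(\<Sum>p\<in>UNIV. \<Sum>q\<in>UNIV. \<kappa> (a i p * a j q) * (t * (\<Sum>k\<in>UNIV. \<Sum>l\<in>UNIV. \<kappa> (c p q k l) * Y k l))) = \<dots>" .
  have antisym: "e' q p - e q p = e p q - e' p q" for p q
    using structure_constants_equivariant[of i j p q]
    by (simp add: e_def e'_def a_def algebra_simps eq_neg_iff_add_eq_0)
  have "(\<Sum>p\<in>UNIV. \<Sum>q\<in>UNIV. \<kappa> (e p q - e' p q) * Y p q)
    = (\<Sum>p\<in>UNIV. \<Sum>q\<in>UNIV. \<kappa> (e p q - e' p q) * (nc_var p * nc_var q))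
      + (\<Sum>p\<in>UNIV. \<Sum>q\<in>UNIV. \<kappa> (e p q - e' p q) * (nc_var q * nc_var p))"
    by (simp add: Y_def distrib_left sum.distrib)
  also have "(\<Sum>p\<in>UNIV. \<Sum>q\<in>UNIV. \<kappa> (e p q - e' p q) * (nc_var q * nc_var p))
    = (\<Sum>q\<in>UNIV. \<Sum>p\<in>UNIV. \<kappa> (e' q p - e q p) * (nc_var q * nc_var p))"
    by (subst sum.swap) (simp only: antisym)
  also have "(\<Sum>p\<in>UNIV. \<Sum>q\<in>UNIV. \<kappa> (e p q - e' p q) * (nc_var p * nc_var q)) + \<dots> = 0"
    by (simp add: \<kappa>_def scalar.const_diff left_diff_distrib sum_subtractf)
  finally have EE': "(\<Sum>p\<in>UNIV. \<Sum>q\<in>UNIV. \<kappa> (e p q) * Y p q) = (\<Sum>p\<in>UNIV. \<Sum>q\<in>UNIV. \<kappa> (e' p q) * Y p q)"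
    by (simp add: \<kappa>_def scalar.const_diff left_diff_distrib sum_subtractf)
  have "nc_linear_subst a (quantization_relation c i j)
    = (nc_linear_form (a i) * nc_linear_form (a j) - nc_linear_form (a j) * nc_linear_form (a i))
      - t * (\<Sum>k\<in>UNIV. \<Sum>l\<in>UNIV. \<kappa> (c i j k l)
          * (nc_linear_form (a k) * nc_linear_form (a l) + nc_linear_form (a l) * nc_linear_form (a k)))"
    unfolding quantization_relation_def t_def \<kappa>_def nc_linear_subst_diff nc_linear_subst_mult
      nc_linear_subst_sum nc_linear_subst_add nc_linear_subst_var nc_linear_subst_const ..
  also have "\<dots> = (\<Sum>p\<in>UNIV. \<Sum>q\<in>UNIV. \<kappa> (a i p * a j q) * (nc_var p * nc_var q - nc_var q * nc_var p))
      - t * (\<Sum>p\<in>UNIV. \<Sum>q\<in>UNIV. \<kappa> (e' p q) * Y p q)"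
    by (simp only: sym comm E EE')
  also have "\<dots> = (\<Sum>p\<in>UNIV. \<Sum>q\<in>UNIV. \<kappa> (a i p * a j q) * quantization_relation c p q)"
    by (simp only: rel E'[symmetric] right_diff_distrib sum_subtractf)
  finally show ?thesis by (simp only: \<kappa>_def)
qed

lemma nc_linear_subst_quantization_ideal:
  assumes "p \<in> quantization_ideal c"
  shows "nc_linear_subst (linear_matrix \<phi>) p \<in> quantization_ideal c"
proof -
  have "ideal {p. nc_linear_subst (linear_matrix \<phi>) p \<in> quantization_ideal c} ring_of_type_algebra"
    by (rule ring_of_type_algebra_idealI)
       (simp_all add: nc_linear_subst_add nc_linear_subst_mult quantization_ideal_zero
         quantization_ideal_add quantization_ideal_mult_left quantization_ideal_mult_right)
  then have "quantization_ideal c \<subseteq> {p. nc_linear_subst (linear_matrix \<phi>) p \<in> quantization_ideal c}"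
    by (rule quantization_ideal_subset)
       (auto simp: nc_linear_subst_quantization_relation
         intro!: quantization_ideal_sum quantization_ideal_mult_left quantization_relation_mem)
  with assms show ?thesis by auto
qed

text \<open>
  Substitution preserves \<open>I\<close>, so all members of a coset contribute the same coset to the union.
\<close>

lemma quantization_map_class:
  "quantization_map c (linear_matrix \<phi>) (quantization_class c p)
    = quantization_class c (nc_linear_subst (linear_matrix \<phi>) p)"
proof -
  have "quantization_class c (nc_linear_subst (linear_matrix \<phi>) q)
      = quantization_class c (nc_linear_subst (linear_matrix \<phi>) p)"
    if "q \<in> quantization_class c p" for q
    using nc_linear_subst_quantization_ideal[of "q - p"] that
    by (simp add: mem_quantization_class_iff quantization_class_eq_iff nc_linear_subst_diff)
  then have "(\<Union>q\<in>quantization_class c p. quantization_class c (nc_linear_subst (linear_matrix \<phi>) q))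
      = (\<Union>q\<in>quantization_class c p. quantization_class c (nc_linear_subst (linear_matrix \<phi>) p))"
    by (rule SUP_cong[OF refl])
  then show ?thesis
    using quantization_class_mem[of p c] unfolding quantization_map_def by (metis UN_constant empty_iff)
qed

end

text \<open>
  As \<open>\<phi>\<close> and \<open>nc_linear_subst\<close> both substitute linear forms for the variables, the matrix of
  \<open>\<phi> \<circ> \<psi>\<close> is the product of the matrices in the opposite order, on both sides.
\<close>

lemma nc_linear_subst_comp:
  assumes "graded_poisson_automorphism br c \<phi>" "graded_poisson_automorphism br c \<psi>"
  shows "nc_linear_subst (linear_matrix \<phi>) (nc_linear_subst (linear_matrix \<psi>) p)
    = nc_linear_subst (linear_matrix (\<phi> \<circ> \<psi>)) p"
proof -
  interpret \<phi>: graded_poisson_automorphism br c \<phi> by fact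
  interpret \<psi>: graded_poisson_automorphism br c \<psi> by fact
  let ?a = "linear_matrix \<phi>" and ?b = "linear_matrix \<psi>"
  have matrix: "linear_matrix (\<phi> \<circ> \<psi>) i k = (\<Sum>j\<in>UNIV. ?b i j * ?a j k)" for i k
  proof -
    have "\<phi> (\<psi> (pvar i)) = (\<Sum>j\<in>UNIV. pconst (?b i j) * \<phi> (pvar j))"
      by (simp add: \<psi>.aut_var \<phi>.aut_sum \<phi>.aut_const_mult)
    then show ?thesis
      by (simp add: linear_matrix_def[of "\<phi> \<circ> \<psi>"] linear_matrix_def[of \<phi>] lookup_sum lookup_pconst_mult)
  qed
  have form: "nc_linear_subst ?a (nc_linear_form (?b i)) = nc_linear_form (linear_matrix (\<phi> \<circ> \<psi>) i)" for i
  proof -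
    have "nc_linear_subst ?a (nc_linear_form (?b i))
      = (\<Sum>j\<in>UNIV. \<Sum>k\<in>UNIV. nc_const (fps_const (?b i j * ?a j k)) * nc_var k)"
      by (simp add: nc_linear_form_def[of "?b i"] nc_linear_subst_sum nc_linear_subst_mult)
         (simp add: nc_linear_form_def sum_distrib_left scalar.const_mult mult.assoc)
    also have "\<dots> = nc_linear_form (linear_matrix (\<phi> \<circ> \<psi>) i)"
      by (subst sum.swap) (simp add: nc_linear_form_def[abs_def] matrix scalar.const_sum sum_distrib_right)
    finally show ?thesis .
  qed
  show ?thesis
    by (rule additive_eqI[where f = "\<lambda>p. nc_linear_subst ?a (nc_linear_subst ?b p)"])
       (simp_all add: nc_linear_subst_add nc_linear_subst_single nc_linear_subst_mult
         nc_linear_subst_prod_list form del: o_apply)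
qed


section \<open>Averaging\<close>

locale quantized_action = quantized_bracket br c
  for br :: "'k::field_char_0 pol \<Rightarrow> 'k pol \<Rightarrow> 'k pol" and c :: "3 \<Rightarrow> 3 \<Rightarrow> 3 \<Rightarrow> 3 \<Rightarrow> 'k" +
  fixes G :: "('k pol \<Rightarrow> 'k pol) set"
  assumes subgroup: "subgroup G (graded_poisson_Aut br)" and finite_group: "finite G"
begin

lemma automorphism: "\<phi> \<in> G \<Longrightarrow> graded_poisson_automorphism br c \<phi>"
  using subgroup.subset[OF subgroup]
  by (intro graded_poisson_automorphism.intro graded_poisson_automorphism_axioms.intro quantized_bracket_axioms) auto

lemma comp_closed: "\<phi> \<in> G \<Longrightarrow> \<psi> \<in> G \<Longrightarrow> \<phi> \<circ> \<psi> \<in> G"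
  using subgroup.m_closed[OF subgroup, of \<phi> \<psi>] by (simp add: graded_poisson_Aut_def)

lemma card_group_nonzero: "(of_nat (card G) :: 'k) \<noteq> 0"
  using subgroup.one_closed[OF subgroup] finite_group by auto

text \<open>
  Translation is injective as \<open>\<psi>\<close> is, and therefore surjective by finiteness.
\<close>

lemma translation_bij: "\<psi> \<in> G \<Longrightarrow> bij_betw (\<lambda>\<phi>. \<psi> \<circ> \<phi>) G G"
proof -
  assume \<psi>: "\<psi> \<in> G"
  interpret \<psi>: graded_poisson_automorphism br c \<psi> by (rule automorphism[OF \<psi>])
  have "inj_on (\<lambda>\<phi>. \<psi> \<circ> \<phi>) G"
    using \<psi>.aut_bij by (auto intro!: inj_onI simp: bij_def fun.inj_map_strong fun_eq_iff inj_eq)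
  moreover have "(\<lambda>\<phi>. \<psi> \<circ> \<phi>) ` G \<subseteq> G" using \<psi> comp_closed by auto
  ultimately show ?thesis
    using finite_group by (simp add: bij_betw_def endo_inj_surj)
qed

abbreviation act :: "('k pol \<Rightarrow> 'k pol) \<Rightarrow> 'k nc_pol \<Rightarrow> 'k nc_pol"
  where "act \<phi> \<equiv> nc_linear_subst (linear_matrix \<phi>)"

definition average :: "'k nc_pol \<Rightarrow> 'k nc_pol"
  where "average p = nc_const (fps_const (inverse (of_nat (card G)))) * (\<Sum>\<phi>\<in>G. act \<phi> p)"

lemma act_average: "\<psi> \<in> G \<Longrightarrow> act \<psi> (average p) = average p"
proof -
  assume \<psi>: "\<psi> \<in> G"
  have "act \<psi> (\<Sum>\<phi>\<in>G. act \<phi> p) = (\<Sum>\<phi>\<in>G. act (\<psi> \<circ> \<phi>) p)"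
    unfolding nc_linear_subst_sum
    by (intro sum.cong refl nc_linear_subst_comp[OF automorphism automorphism] \<psi>)
  also have "\<dots> = (\<Sum>\<phi>\<in>G. act \<phi> p)"
    by (rule sum.reindex_bij_betw[OF translation_bij[OF \<psi>], of "\<lambda>\<phi>. act \<phi> p"])
  finally show ?thesis
    by (simp add: average_def nc_linear_subst_mult)
qed

lemma average_constant_orbit:
  "nc_const (fps_const (inverse (of_nat (card G)))) * (\<Sum>\<phi>\<in>G. p) = p" for p :: "'k nc_pol"
proof -
  have "nc_const (fps_const (inverse (of_nat (card G)))) * (of_nat (card G) :: 'k nc_pol)
    = nc_const (fps_const (inverse (of_nat (card G)) * of_nat (card G)))"
    by (simp only: scalar.const_mult scalar.const_of_nat)
  also have "\<dots> = 1"
    using card_group_nonzero by (simp add: nc.const_one)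
  finally show ?thesis
    by (simp only: sum_constant mult.assoc[symmetric] mult_1_left)
qed

lemma average_add: "average (p + q) = average p + average q"
  by (simp add: average_def nc_linear_subst_add sum.distrib distrib_left)

lemma average_hbar: "average (nc_const fps_X * q) = nc_const fps_X * average q"
  unfolding average_def nc_linear_subst_mult nc_linear_subst_const sum_distrib_left[symmetric]
    mult.assoc[symmetric]
    nc.const_central[of fps_X "nc_const (fps_const (inverse (of_nat (card G))))"] ..

lemma average_quantization_ideal: "p \<in> quantization_ideal c \<Longrightarrow> average p \<in> quantization_ideal c"
  unfolding average_def
  by (intro quantization_ideal_mult_left quantization_ideal_sum
      graded_poisson_automorphism.nc_linear_subst_quantization_ideal[OF automorphism])

text \<open>
  The difference is the average of the elements \<open>act \<phi> p - p\<close> of \<open>I\<close>.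
\<close>

lemma average_congruent:
  assumes "\<And>\<phi>. \<phi> \<in> G \<Longrightarrow> act \<phi> p - p \<in> quantization_ideal c"
  shows "average p - p \<in> quantization_ideal c"
proof -
  have "average p - p = nc_const (fps_const (inverse (of_nat (card G)))) * (\<Sum>\<phi>\<in>G. act \<phi> p - p)"
    using average_constant_orbit[of p] by (simp add: average_def sum_subtractf right_diff_distrib)
  then show ?thesis
    using assms by (auto intro!: quantization_ideal_mult_left quantization_ideal_sum)
qed

lemma reduction_average:
  assumes "\<And>\<phi>. \<phi> \<in> G \<Longrightarrow> \<phi> (reduction p) = reduction p"
  shows "reduction (average p) = reduction p"
proof -
  have "reduction (average p)
      = reduction (nc_const (fps_const (inverse (of_nat (card G)))) * (\<Sum>\<phi>\<in>G. p))"
    unfolding average_def reduction_mult reduction_sum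
    by (intro arg_cong2[of _ _ _ _ "(*)"] sum.cong refl)
       (simp add: graded_poisson_automorphism.reduction_nc_linear_subst[OF automorphism] assms)
  then show ?thesis by (simp only: average_constant_orbit)
qed

end


section \<open>Transport of algebra structures\<close>

lemma cring_cong:
  assumes "cring A"
    and eq: "carrier B = carrier A" "monoid.mult B = monoid.mult A" "one B = one A"
      "ring.zero B = ring.zero A" "add B = add A"
  shows "cring B"
proof -
  interpret A: cring A by fact
  show ?thesis
  proof (rule cringI)
    show "abelian_group B"
      by (rule abelian_groupI)
        (auto simp: eq A.a_ac intro: A.add.l_inv_ex)
    show "comm_monoid B"
      by (rule comm_monoidI) (auto simp: eq A.m_ac)
  qed (simp add: eq A.l_distr)
qed

lemma algebra_algebra_via:
  assumes "cring K" "cring R" "s \<in> ring_hom K R"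
  shows "algebra K (algebra_via R s)"
proof -
  interpret K: cring K by fact
  interpret R: cring R by fact
  have [simp]: "a \<in> carrier K \<Longrightarrow> s a \<in> carrier R" for a
    using ring_hom_closed[OF assms(3)] .
  have sel: "carrier (algebra_via R s) = carrier R" "monoid.mult (algebra_via R s) = monoid.mult R"
      "one (algebra_via R s) = one R" "ring.zero (algebra_via R s) = ring.zero R"
      "add (algebra_via R s) = add R" "module.smult (algebra_via R s) = (\<lambda>a x. s a \<otimes>\<^bsub>R\<^esub> x)"
    by (simp_all add: algebra_via_def)
  have "cring (algebra_via R s)"
    by (rule cring_cong[OF assms(2)]) (simp_all add: sel)
  then show ?thesis
    by (rule algebraI[OF assms(1)])
      (simp_all add: sel ring_hom_add[OF assms(3)] ring_hom_mult[OF assms(3)] ring_hom_one[OF assms(3)]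
        R.l_distr R.r_distr R.m_assoc)
qed

lemma algebra_with_bracket:
  assumes "algebra K M"
  shows "algebra K (with_bracket M B)"
proof -
  interpret M: algebra K M by fact
  have "cring (with_bracket M B)"
    by (rule cring_cong[OF M.M_cring]) simp_all
  then show ?thesis
    by (rule algebraI[OF M.R_cring])
      (simp_all add: M.smult_l_distr M.smult_r_distr M.smult_assoc1 M.smult_assoc2)
qed

text \<open>
  Transport of structure: each Poisson identity for \<open>B\<close> holds because \<open>h\<close> is injective and maps both sides
  to the two sides of the same identity in \<open>N\<close>.
\<close>

lemma isomorphic_poisson_algebras_with_bracket:
  assumes M: "algebra K M" and N: "poisson_algebra K N" and h: "h \<in> algebra_iso K M N"
    and B_closed: "\<And>x y. x \<in> carrier M \<Longrightarrow> y \<in> carrier M \<Longrightarrow> B x y \<in> carrier M"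
    and h_B: "\<And>x y. x \<in> carrier M \<Longrightarrow> y \<in> carrier M \<Longrightarrow> h (B x y) = \<lbrace>h x, h y\<rbrace>\<^bsub>N\<^esub>"
  shows "isomorphic_poisson_algebras K (with_bracket M B) N"
proof -
  interpret M: algebra K M by fact
  interpret N: poisson_algebra K N by fact
  have hom: "h \<in> ring_hom M N" and inj: "inj_on h (carrier M)" and bij: "bij_betw h (carrier M) (carrier N)"
    using h by (auto simp: algebra_iso_def ring_iso_def bij_betw_def)
  have smult: "h (a \<odot>\<^bsub>M\<^esub> x) = a \<odot>\<^bsub>N\<^esub> h x" if "a \<in> carrier K" "x \<in> carrier M" for a x
    using h that by (auto simp: algebra_iso_def)
  note h_simps = ring_hom_closed[OF hom] ring_hom_add[OF hom] ring_hom_mult[OF hom]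
    ring_hom_zero[OF hom M.ring_axioms N.ring_axioms] smult h_B B_closed
  have "poisson_algebra K (with_bracket M B)"
  proof (rule poisson_algebra.intro[OF algebra_with_bracket[OF M]], unfold_locales)
    fix x assume "x \<in> carrier (with_bracket M B)"
    then show "\<lbrace>x, x\<rbrace>\<^bsub>with_bracket M B\<^esub> = \<zero>\<^bsub>with_bracket M B\<^esub>"
      by (intro inj_onD[OF inj]) (simp_all add: h_simps N.bracket_self)
  next
    fix x y assume "x \<in> carrier (with_bracket M B)" "y \<in> carrier (with_bracket M B)"
    then show "\<lbrace>x, y\<rbrace>\<^bsub>with_bracket M B\<^esub> \<in> carrier (with_bracket M B)"
      by (simp add: B_closed)
    fix a assume "a \<in> carrier K"
    with \<open>x \<in> _\<close> \<open>y \<in> _\<close> show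
      "\<lbrace>a \<odot>\<^bsub>with_bracket M B\<^esub> x, y\<rbrace>\<^bsub>with_bracket M B\<^esub> = a \<odot>\<^bsub>with_bracket M B\<^esub> \<lbrace>x, y\<rbrace>\<^bsub>with_bracket M B\<^esub>"
      "\<lbrace>x, a \<odot>\<^bsub>with_bracket M B\<^esub> y\<rbrace>\<^bsub>with_bracket M B\<^esub> = a \<odot>\<^bsub>with_bracket M B\<^esub> \<lbrace>x, y\<rbrace>\<^bsub>with_bracket M B\<^esub>"
      by (intro inj_onD[OF inj]; simp add: h_simps N.bracket_smult_l N.bracket_smult_r)+
  next
    fix x y z
    assume xyz: "x \<in> carrier (with_bracket M B)" "y \<in> carrier (with_bracket M B)" "z \<in> carrier (with_bracket M B)"
    show "\<lbrace>x \<oplus>\<^bsub>with_bracket M B\<^esub> y, z\<rbrace>\<^bsub>with_bracket M B\<^esub>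
        = \<lbrace>x, z\<rbrace>\<^bsub>with_bracket M B\<^esub> \<oplus>\<^bsub>with_bracket M B\<^esub> \<lbrace>y, z\<rbrace>\<^bsub>with_bracket M B\<^esub>"
      using xyz by (intro inj_onD[OF inj]; simp add: h_simps N.bracket_add_l)
    show "\<lbrace>x, y \<oplus>\<^bsub>with_bracket M B\<^esub> z\<rbrace>\<^bsub>with_bracket M B\<^esub>
        = \<lbrace>x, y\<rbrace>\<^bsub>with_bracket M B\<^esub> \<oplus>\<^bsub>with_bracket M B\<^esub> \<lbrace>x, z\<rbrace>\<^bsub>with_bracket M B\<^esub>"
      using xyz by (intro inj_onD[OF inj]; simp add: h_simps N.bracket_add_r)
    show "\<lbrace>x, \<lbrace>y, z\<rbrace>\<^bsub>with_bracket M B\<^esub>\<rbrace>\<^bsub>with_bracket M B\<^esub>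
        \<oplus>\<^bsub>with_bracket M B\<^esub> \<lbrace>y, \<lbrace>z, x\<rbrace>\<^bsub>with_bracket M B\<^esub>\<rbrace>\<^bsub>with_bracket M B\<^esub>
        \<oplus>\<^bsub>with_bracket M B\<^esub> \<lbrace>z, \<lbrace>x, y\<rbrace>\<^bsub>with_bracket M B\<^esub>\<rbrace>\<^bsub>with_bracket M B\<^esub> = \<zero>\<^bsub>with_bracket M B\<^esub>"
      using xyz by (intro inj_onD[OF inj]; simp add: h_simps N.bracket_jacobi)
    show "\<lbrace>x, y \<otimes>\<^bsub>with_bracket M B\<^esub> z\<rbrace>\<^bsub>with_bracket M B\<^esub>
        = y \<otimes>\<^bsub>with_bracket M B\<^esub> \<lbrace>x, z\<rbrace>\<^bsub>with_bracket M B\<^esub>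
          \<oplus>\<^bsub>with_bracket M B\<^esub> \<lbrace>x, y\<rbrace>\<^bsub>with_bracket M B\<^esub> \<otimes>\<^bsub>with_bracket M B\<^esub> z"
      using xyz by (intro inj_onD[OF inj]; simp add: h_simps N.bracket_leibniz)
  qed
  moreover have "h \<in> poisson_iso K (with_bracket M B) N"
    using bij by (auto simp: poisson_iso_def algebra_iso_def ring_iso_def smult h_B
        intro!: ring_hom_memI simp: h_simps ring_hom_one[OF hom])
  ultimately show ?thesis
    using N unfolding isomorphic_poisson_algebras_def by blast
qed


section \<open>The invariant subalgebra of \<open>k[x\<^sub>1, x\<^sub>2, x\<^sub>3]\<close>\<close>

lemma pol_invariants_simps [simp]:
  "carrier (pol_invariants br G) = {p. \<forall>\<phi>\<in>G. \<phi> p = p}" "monoid.mult (pol_invariants br G) = (*)"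
  "one (pol_invariants br G) = 1" "ring.zero (pol_invariants br G) = 0" "add (pol_invariants br G) = (+)"
  "module.smult (pol_invariants br G) = (\<lambda>a p. pconst a * p)" "pbracket (pol_invariants br G) = br"
  by (simp_all add: pol_invariants_def)

context quantized_action
begin

lemma pol_invariants_poisson: "poisson_algebra ring_of_type_algebra (pol_invariants br G)"
proof -
  interpret P: poisson_algebra ring_of_type_algebra "pol_poisson br" by (rule poisson)
  note aut_simps = graded_poisson_automorphism.aut_add[OF automorphism]
    graded_poisson_automorphism.aut_mult[OF automorphism]
    graded_poisson_automorphism.aut_zero[OF automorphism]
    graded_poisson_automorphism.aut_one[OF automorphism]
    graded_poisson_automorphism.aut_const[OF automorphism]
  have neg: "\<phi> (- p) = - p" if "\<phi> \<in> G" "\<phi> p = p" for \<phi> p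
    using graded_poisson_automorphism.aut_add[OF automorphism[OF that(1)], of p "- p"]
      graded_poisson_automorphism.aut_zero[OF automorphism[OF that(1)]] that(2)
    by (simp add: eq_neg_iff_add_eq_0 add.commute)
  have "cring (pol_invariants br G)"
  proof (rule cringI)
    show "abelian_group (pol_invariants br G)"
      by (rule abelian_groupI) (auto simp: aut_simps neg add.assoc add.commute intro!: exI[of _ "- _"])
    show "comm_monoid (pol_invariants br G)"
      by (rule comm_monoidI) (auto simp: aut_simps mult.assoc mult.commute)
  qed (simp add: distrib_right)
  then have "algebra ring_of_type_algebra (pol_invariants br G)"
    by (rule algebraI[OF P.R_cring])
      (auto simp: aut_simps pol.const_add pol.const_mult pol.const_one distrib_left distrib_right mult.assoc)
  then show ?thesis
  proof (rule poisson_algebra.intro, unfold_locales)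
    fix p q assume pq: "p \<in> carrier (pol_invariants br G)" "q \<in> carrier (pol_invariants br G)"
    have "\<phi> (br p q) = br p q" if "\<phi> \<in> G" for \<phi>
    proof -
      have "\<phi> p = p" "\<phi> q = q" using pq that by auto
      then show ?thesis
        using graded_poisson_automorphism.aut_bracket[OF automorphism[OF that], of p q] by simp
    qed
    then show "\<lbrace>p, q\<rbrace>\<^bsub>pol_invariants br G\<^esub> \<in> carrier (pol_invariants br G)"
      by simp
  qed (use P.bracket_jacobi in \<open>simp_all add: br_add_left br_add_right br_const_left br_const_right br_self\<close>,
      simp_all only: br_leibniz_right)
qed


section \<open>The invariant subring of the quantization\<close>

text \<open>
  The class of \<open>p\<close> is invariant; \<open>p\<close> itself need not be. Working with representatives replaces the maps on
  cosets by substitutions in the free algebra.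
\<close>

definition invariant_mod :: "'k nc_pol \<Rightarrow> bool"
  where "invariant_mod p \<longleftrightarrow> (\<forall>\<phi>\<in>G. act \<phi> p - p \<in> quantization_ideal c)"

abbreviation Q :: "'k nc_pol set ring"
  where "Q \<equiv> quantized_invariants c G"

abbreviation cls :: "'k nc_pol \<Rightarrow> 'k nc_pol set"
  where "cls \<equiv> quantization_class c"

lemma carrier_Q: "carrier Q = cls ` {p. invariant_mod p}"
proof -
  have "(\<forall>\<psi>\<in>quantized_group c G. \<psi> (cls p) = cls p) \<longleftrightarrow> invariant_mod p" for p
    by (simp add: quantized_group_def invariant_mod_def quantization_class_eq_iff
        graded_poisson_automorphism.quantization_map_class[OF automorphism])
  then show ?thesis
    by (auto simp: quantized_invariants_def carrier_quantization)
qed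

lemma Q_simps:
  "cls p \<otimes>\<^bsub>Q\<^esub> cls q = cls (p * q)" "cls p \<oplus>\<^bsub>Q\<^esub> cls q = cls (p + q)"
  "\<one>\<^bsub>Q\<^esub> = cls 1" "\<zero>\<^bsub>Q\<^esub> = cls 0"
  by (simp_all add: quantized_invariants_def quantization_class_mult quantization_class_add
      quantization_class_one quantization_class_zero)

lemma invariant_mod_const: "invariant_mod (nc_const s)"
  by (simp add: invariant_mod_def quantization_ideal_zero)

lemma invariant_mod_one: "invariant_mod 1"
  using invariant_mod_const[of 1] by (simp add: nc.const_one)

lemma invariant_mod_average: "invariant_mod (average p)"
  by (simp add: invariant_mod_def act_average quantization_ideal_zero)

lemma invariant_mod_add: "invariant_mod p \<Longrightarrow> invariant_mod q \<Longrightarrow> invariant_mod (p + q)"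
  using quantization_ideal_add by (fastforce simp: invariant_mod_def nc_linear_subst_add add_diff_add)

lemma invariant_mod_mult:
  assumes "invariant_mod p" "invariant_mod q"
  shows "invariant_mod (p * q)"
  unfolding invariant_mod_def
proof
  fix \<phi> assume \<phi>: "\<phi> \<in> G"
  have eq: "act \<phi> (p * q) - p * q = (act \<phi> p - p) * act \<phi> q + p * (act \<phi> q - q)"
    by (simp add: nc_linear_subst_mult algebra_simps)
  show "act \<phi> (p * q) - p * q \<in> quantization_ideal c"
    unfolding eq using assms \<phi>
    by (intro quantization_ideal_add quantization_ideal_mult_left quantization_ideal_mult_right)
      (auto simp: invariant_mod_def)
qed

lemma invariant_mod_uminus: "invariant_mod p \<Longrightarrow> invariant_mod (- p)"
  using invariant_mod_mult[OF invariant_mod_const[of "- 1"], of p]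
  by (simp add: nc.const_uminus nc.const_one)

lemma invariant_mod_diff: "invariant_mod p \<Longrightarrow> invariant_mod q \<Longrightarrow> invariant_mod (p - q)"
  using invariant_mod_add[of p "- q"] invariant_mod_uminus by simp

lemma cls_in_Q: "invariant_mod p \<Longrightarrow> cls p \<in> carrier Q"
  by (auto simp: carrier_Q)

lemma Q_E:
  assumes "f \<in> carrier Q"
  obtains p where "invariant_mod p" "f = cls p"
  using assms by (auto simp: carrier_Q)

lemma ring_Q: "ring Q"
proof -
  interpret R: ring "quantization c" by (rule quantization_ring)
  have uminus: "\<ominus>\<^bsub>quantization c\<^esub> cls p = cls (- p)" for p
    by (rule R.minus_equality)
      (simp_all add: quantization_class_add quantization_class_zero carrier_quantization)
  have "subring (carrier Q) (quantization c)"
    by (rule R.subringI)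
      (auto simp: carrier_Q carrier_quantization uminus quantization_class_one quantization_class_mult
        quantization_class_add invariant_mod_one
        intro!: imageI invariant_mod_uminus invariant_mod_mult invariant_mod_add)
  then have "ring ((quantization c)\<lparr>carrier := carrier Q\<rparr>)"
    by (rule R.subring_is_ring)
  then show ?thesis by (simp add: quantized_invariants_def)
qed

lemma Q_minus:
  assumes "invariant_mod p" "invariant_mod q"
  shows "cls p \<ominus>\<^bsub>Q\<^esub> cls q = cls (p - q)"
proof -
  interpret Q: ring Q by (rule ring_Q)
  have "\<ominus>\<^bsub>Q\<^esub> cls q = cls (- q)"
    by (rule Q.minus_equality) (simp_all add: Q_simps cls_in_Q assms invariant_mod_uminus)
  then show ?thesis by (simp add: a_minus_def Q_simps)
qed


section \<open>The quotient by \<open>\<hbar>\<close>\<close>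

text \<open>
  Any representative may be chosen, because the reduction vanishes on \<open>I\<close>.
\<close>

definition class_reduction :: "'k nc_pol set \<Rightarrow> 'k pol"
  where "class_reduction f = reduction (SOME p. p \<in> f)"

lemma class_reduction_class [simp]: "class_reduction (cls p) = reduction p"
proof -
  have "(SOME q. q \<in> cls p) \<in> cls p"
    using quantization_class_mem by (rule someI)
  then show ?thesis
    unfolding class_reduction_def by (intro reduction_cong) (simp add: mem_quantization_class_iff)
qed

lemma reduction_invariant:
  assumes "invariant_mod p" "\<phi> \<in> G"
  shows "\<phi> (reduction p) = reduction p"
  using assms reduction_cong[of "act \<phi> p" p]
  by (simp add: invariant_mod_def graded_poisson_automorphism.reduction_nc_linear_subst[OF automorphism])

lemma class_reduction_hom: "ring_hom_ring Q (pol_invariants br G) class_reduction"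
proof (rule ring_hom_ringI)
  interpret P: poisson_algebra ring_of_type_algebra "pol_invariants br G" by (rule pol_invariants_poisson)
  show "ring (pol_invariants br G)" by (rule P.ring_axioms)
qed (auto elim!: Q_E simp: ring_Q Q_simps reduction_invariant reduction_mult reduction_add)

text \<open>
  An invariant polynomial is lifted by the section \<^term>\<open>ordered_lift\<close>, and the lift is averaged; since the action
  commutes with the reduction, averaging does not change the reduction.
\<close>

lemma class_reduction_surj: "class_reduction ` carrier Q = carrier (pol_invariants br G)"
proof
  show "class_reduction ` carrier Q \<subseteq> carrier (pol_invariants br G)"
    by (auto simp: carrier_Q reduction_invariant)
  show "carrier (pol_invariants br G) \<subseteq> class_reduction ` carrier Q"
  proof
    fix f assume "f \<in> carrier (pol_invariants br G)"
    then have "reduction (average (ordered_lift f)) = f"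
      by (subst reduction_average) auto
    then have "f = class_reduction (cls (average (ordered_lift f)))"
      by simp
    then show "f \<in> class_reduction ` carrier Q"
      using cls_in_Q[OF invariant_mod_average] by blast
  qed
qed

lemma hbar_mult_class: "hbar c \<otimes>\<^bsub>Q\<^esub> cls q = cls (nc_const fps_X * q)"
  by (simp add: hbar_def Q_simps)

text \<open>
  If the invariant class of \<open>p\<close> reduces to \<open>0\<close>, then \<open>p = r + \<hbar> q\<close> with \<open>r \<in> I\<close>, where the class of \<open>q\<close> need not
  be invariant. Averaging both sides replaces \<open>q\<close> by an invariant element.
\<close>

lemma kernel_class_reduction: "a_kernel Q (pol_invariants br G) class_reduction = hbar_ideal c G"
proof
  show "a_kernel Q (pol_invariants br G) class_reduction \<subseteq> hbar_ideal c G"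
  proof
    fix f assume "f \<in> a_kernel Q (pol_invariants br G) class_reduction"
    then obtain p where p: "invariant_mod p" "f = cls p" "reduction p = 0"
      by (auto simp: a_kernel_def' elim: Q_E)
    from p(3) obtain r q where r: "r \<in> quantization_ideal c" and pq: "p = r + nc_const fps_X * q"
      by (rule reduction_eq_zeroD)
    have "average p - p \<in> quantization_ideal c"
      using p(1) by (intro average_congruent) (simp add: invariant_mod_def)
    moreover have "average p = average r + nc_const fps_X * average q"
      by (simp add: pq average_add average_hbar)
    ultimately have "p - nc_const fps_X * average q \<in> quantization_ideal c"
      using quantization_ideal_diff[OF average_quantization_ideal[OF r], of "average p - p"]
      by (simp add: algebra_simps)
    then have "f = hbar c \<otimes>\<^bsub>Q\<^esub> cls (average q)"
      by (simp add: p(2) hbar_mult_class quantization_class_eq_iff)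
    then show "f \<in> hbar_ideal c G"
      using cls_in_Q[OF invariant_mod_average] unfolding hbar_ideal_def by blast
  qed
  show "hbar_ideal c G \<subseteq> a_kernel Q (pol_invariants br G) class_reduction"
    by (auto simp: hbar_ideal_def a_kernel_def' hbar_mult_class reduction_mult pol.const_zero
        intro!: cls_in_Q invariant_mod_mult invariant_mod_const elim!: Q_E)
qed

text \<open>
  The isomorphism \<open>Q\<^sub>\<hbar> / (\<hbar>) \<rightarrow> P\<^sup>G\<close> of the first isomorphism theorem.
\<close>

definition residue_reduction :: "'k nc_pol set set \<Rightarrow> 'k pol"
  where "residue_reduction U = the_elem (class_reduction ` U)"

lemma residue_reduction_iso:
  "residue_reduction \<in> ring_iso (Q Quot hbar_ideal c G) (pol_invariants br G)"
  using ring_hom_ring.FactRing_iso_set[OF class_reduction_hom class_reduction_surj]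
  unfolding kernel_class_reduction residue_reduction_def[abs_def] .

lemma residue_reduction_class:
  "f \<in> carrier Q \<Longrightarrow> residue_reduction (residue_class c G f) = class_reduction f"
  using ring_hom_ring.the_elem_simp[OF class_reduction_hom]
  unfolding kernel_class_reduction residue_reduction_def residue_class_def by simp

lemma hbar_ideal_ideal: "ideal (hbar_ideal c G) Q"
  using ring_hom_ring.kernel_is_ideal[OF class_reduction_hom] unfolding kernel_class_reduction .

lemma residue_class_hom: "residue_class c G \<in> ring_hom Q (Q Quot hbar_ideal c G)"
  using ideal.rcos_ring_hom[OF hbar_ideal_ideal] unfolding residue_class_def[abs_def] .

lemma residue_ring: "ring (Q Quot hbar_ideal c G)"
  by (rule ideal.quotient_is_ring[OF hbar_ideal_ideal])

lemma residue_cring: "cring (Q Quot hbar_ideal c G)"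
proof -
  interpret R: ring "Q Quot hbar_ideal c G" by (rule residue_ring)
  have hom: "residue_reduction \<in> ring_hom (Q Quot hbar_ideal c G) (pol_invariants br G)"
    and inj: "inj_on residue_reduction (carrier (Q Quot hbar_ideal c G))"
    using residue_reduction_iso by (auto simp: ring_iso_def bij_betw_def)
  show ?thesis
  proof (intro cring.intro residue_ring comm_monoid.intro R.monoid_axioms comm_monoid_axioms.intro)
    fix U V assume XY: "U \<in> carrier (Q Quot hbar_ideal c G)" "V \<in> carrier (Q Quot hbar_ideal c G)"
    then show "U \<otimes>\<^bsub>Q Quot hbar_ideal c G\<^esub> V = V \<otimes>\<^bsub>Q Quot hbar_ideal c G\<^esub> U"
      by (intro inj_onD[OF inj]) (simp_all add: ring_hom_mult[OF hom] mult.commute)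
  qed
qed

abbreviation scalar_residue :: "'k \<Rightarrow> 'k nc_pol set set"
  where "scalar_residue a \<equiv> residue_class c G (cls (nc_const (fps_const a)))"

lemma scalar_in_Q: "cls (nc_const s) \<in> carrier Q"
  by (rule cls_in_Q[OF invariant_mod_const])

lemma scalar_residue_hom: "scalar_residue \<in> ring_hom ring_of_type_algebra (Q Quot hbar_ideal c G)"
proof (rule ring_hom_memI)
  fix a b :: 'k
  show "scalar_residue a \<in> carrier (Q Quot hbar_ideal c G)"
    by (rule ring_hom_closed[OF residue_class_hom scalar_in_Q])
  show "scalar_residue (a \<otimes>\<^bsub>ring_of_type_algebra\<^esub> b)
      = scalar_residue a \<otimes>\<^bsub>Q Quot hbar_ideal c G\<^esub> scalar_residue b"
    using ring_hom_mult[OF residue_class_hom scalar_in_Q scalar_in_Q, of "fps_const a" "fps_const b"]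
    unfolding Q_simps scalar.const_mult[symmetric] by simp
  show "scalar_residue (a \<oplus>\<^bsub>ring_of_type_algebra\<^esub> b)
      = scalar_residue a \<oplus>\<^bsub>Q Quot hbar_ideal c G\<^esub> scalar_residue b"
    using ring_hom_add[OF residue_class_hom scalar_in_Q scalar_in_Q, of "fps_const a" "fps_const b"]
    unfolding Q_simps scalar.const_add[symmetric] by simp
  show "scalar_residue \<one>\<^bsub>ring_of_type_algebra\<^esub> = \<one>\<^bsub>Q Quot hbar_ideal c G\<^esub>"
    using ring_hom_one[OF residue_class_hom] unfolding Q_simps by (simp add: nc.const_one)
qed

lemma residue_algebra_simps [simp]:
  "carrier (residue_algebra c G) = carrier (Q Quot hbar_ideal c G)"
  "monoid.mult (residue_algebra c G) = monoid.mult (Q Quot hbar_ideal c G)"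
  "one (residue_algebra c G) = one (Q Quot hbar_ideal c G)"
  "ring.zero (residue_algebra c G) = ring.zero (Q Quot hbar_ideal c G)"
  "add (residue_algebra c G) = add (Q Quot hbar_ideal c G)"
  "module.smult (residue_algebra c G) = (\<lambda>a U. scalar_residue a \<otimes>\<^bsub>Q Quot hbar_ideal c G\<^esub> U)"
  by (simp_all add: residue_algebra_def algebra_via_def)

lemma residue_algebra_algebra: "algebra ring_of_type_algebra (residue_algebra c G)"
proof -
  interpret P: poisson_algebra ring_of_type_algebra "pol_poisson br" by (rule poisson)
  show ?thesis
    unfolding residue_algebra_def
    by (rule algebra_algebra_via[OF P.R_cring residue_cring scalar_residue_hom])
qed

lemma residue_reduction_algebra_iso:
  "residue_reduction \<in> algebra_iso ring_of_type_algebra (residue_algebra c G) (pol_invariants br G)"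
proof -
  have hom: "residue_reduction \<in> ring_hom (Q Quot hbar_ideal c G) (pol_invariants br G)"
    using residue_reduction_iso by (simp add: ring_iso_def)
  have "residue_reduction \<in> ring_iso (residue_algebra c G) (pol_invariants br G)"
    using residue_reduction_iso by (simp add: ring_iso_def ring_hom_def)
  moreover have "residue_reduction (scalar_residue a \<otimes>\<^bsub>Q Quot hbar_ideal c G\<^esub> U) = pconst a * residue_reduction U"
    if "U \<in> carrier (Q Quot hbar_ideal c G)" for a U
    using ring_hom_mult[OF hom ring_hom_closed[OF residue_class_hom scalar_in_Q] that]
    by (simp add: residue_reduction_class scalar_in_Q)
  ultimately show ?thesis by (simp add: algebra_iso_def)
qed

lemma residue_algebra_isomorphic:
  "isomorphic_algebras ring_of_type_algebra (residue_algebra c G) (pol_invariants br G)"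
proof -
  interpret P: poisson_algebra ring_of_type_algebra "pol_invariants br G" by (rule pol_invariants_poisson)
  show ?thesis
    unfolding isomorphic_algebras_def
    using residue_algebra_algebra P.algebra_axioms residue_reduction_algebra_iso by blast
qed

text \<open>
  The commutator lies in the kernel of the reduction, as polynomials commute.
\<close>

lemma commutator_divisible_by_hbar:
  assumes "f \<in> carrier Q" "g \<in> carrier Q"
  shows "\<exists>h\<in>carrier Q. f \<otimes>\<^bsub>Q\<^esub> g \<ominus>\<^bsub>Q\<^esub> g \<otimes>\<^bsub>Q\<^esub> f = hbar c \<otimes>\<^bsub>Q\<^esub> h"
proof -
  obtain p q where pq: "invariant_mod p" "f = cls p" "invariant_mod q" "g = cls q"
    using assms by (metis Q_E)
  have "f \<otimes>\<^bsub>Q\<^esub> g \<ominus>\<^bsub>Q\<^esub> g \<otimes>\<^bsub>Q\<^esub> f = cls (p * q - q * p)"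
    by (simp add: pq Q_simps Q_minus invariant_mod_mult)
  also have "\<dots> \<in> a_kernel Q (pol_invariants br G) class_reduction"
    by (simp add: a_kernel_def' cls_in_Q pq invariant_mod_diff invariant_mod_mult reduction_diff
        reduction_mult mult.commute)
  finally show ?thesis unfolding kernel_class_reduction hbar_ideal_def by blast
qed

lemma class_reduction_commutator_quotient:
  assumes "f \<in> carrier Q" "g \<in> carrier Q" "h \<in> carrier Q"
    and "f \<otimes>\<^bsub>Q\<^esub> g \<ominus>\<^bsub>Q\<^esub> g \<otimes>\<^bsub>Q\<^esub> f = hbar c \<otimes>\<^bsub>Q\<^esub> h"
  shows "class_reduction h = br (class_reduction f) (class_reduction g)"
proof -
  obtain p q r where pqr: "invariant_mod p" "f = cls p" "invariant_mod q" "g = cls q"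
      "invariant_mod r" "h = cls r"
    using assms(1-3) by (metis Q_E)
  have "cls (p * q - q * p) = cls (nc_const fps_X * r)"
    using assms(4) by (simp add: pqr Q_simps Q_minus invariant_mod_mult hbar_mult_class)
  then show ?thesis
    by (simp add: pqr quantization_class_eq_iff reduction_commutator_quotient)
qed

text \<open>
  The bracket on the quotient is defined by pulling back that of \<open>P\<^sup>G\<close>, which carries its axioms
  over; injectivity of the reduction on the quotient then identifies it with the residue class of \<open>\<pi> f g\<close>.
\<close>

lemma residue_algebra_poisson_isomorphic:
  assumes "\<forall>f\<in>carrier Q. \<forall>g\<in>carrier Q. \<pi> f g \<in> carrier Q
      \<and> f \<otimes>\<^bsub>Q\<^esub> g \<ominus>\<^bsub>Q\<^esub> g \<otimes>\<^bsub>Q\<^esub> f = hbar c \<otimes>\<^bsub>Q\<^esub> \<pi> f g"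
  shows "\<exists>B. (\<forall>f\<in>carrier Q. \<forall>g\<in>carrier Q.
        B (residue_class c G f) (residue_class c G g) = residue_class c G (\<pi> f g))
      \<and> isomorphic_poisson_algebras ring_of_type_algebra
          (with_bracket (residue_algebra c G) B) (pol_invariants br G)"
proof -
  let ?R = "carrier (Q Quot hbar_ideal c G)"
  define B where "B U V = inv_into ?R residue_reduction (br (residue_reduction U) (residue_reduction V))" for U V
  have bij: "bij_betw residue_reduction ?R (carrier (pol_invariants br G))"
    using residue_reduction_iso by (simp add: ring_iso_def)
  interpret P: poisson_algebra ring_of_type_algebra "pol_invariants br G" by (rule pol_invariants_poisson)
  have bracket: "br (residue_reduction U) (residue_reduction V) \<in> residue_reduction ` ?R" if "U \<in> ?R" "V \<in> ?R" for U V
    using P.bracket_closed[of "residue_reduction U" "residue_reduction V"] bij_betw_apply[OF bij] that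
    unfolding bij_betw_imp_surj_on[OF bij] by simp
  have B_closed: "B U V \<in> ?R" and B_reduction: "residue_reduction (B U V) = br (residue_reduction U) (residue_reduction V)"
    if "U \<in> ?R" "V \<in> ?R" for U V
    using inv_into_into[OF bracket[OF that]] f_inv_into_f[OF bracket[OF that]] by (simp_all add: B_def)
  have "B (residue_class c G f) (residue_class c G g) = residue_class c G (\<pi> f g)"
    if fg: "f \<in> carrier Q" "g \<in> carrier Q" for f g
  proof (rule inj_onD[OF bij_betw_imp_inj_on[OF bij]])
    have \<pi>: "\<pi> f g \<in> carrier Q" using assms fg by blast
    note closed = ring_hom_closed[OF residue_class_hom]
    show "B (residue_class c G f) (residue_class c G g) \<in> ?R" "residue_class c G (\<pi> f g) \<in> ?R"
      by (intro B_closed closed fg \<pi>)+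
    show "residue_reduction (B (residue_class c G f) (residue_class c G g)) = residue_reduction (residue_class c G (\<pi> f g))"
      using class_reduction_commutator_quotient[OF fg \<pi>] assms fg
      by (simp add: B_reduction closed residue_reduction_class \<pi>)
  qed
  moreover have "isomorphic_poisson_algebras ring_of_type_algebra
      (with_bracket (residue_algebra c G) B) (pol_invariants br G)"
    by (rule isomorphic_poisson_algebras_with_bracket[OF residue_algebra_algebra pol_invariants_poisson
          residue_reduction_algebra_iso]) (simp_all add: B_closed B_reduction)
  ultimately show ?thesis by blast
qed

end


theorem theorem0p2:
  fixes br :: "('k::{alg_closed_field, field_char_0}) pol \<Rightarrow> 'k pol \<Rightarrow> 'k pol"
    and c :: "3 \<Rightarrow> 3 \<Rightarrow> 3 \<Rightarrow> 3 \<Rightarrow> 'k"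
    and G :: "('k pol \<Rightarrow> 'k pol) set"
    and K :: "'k ring"
    and Q (structure)
  defines "K \<equiv> ring_of_type_algebra"
    and "Q \<equiv> quantized_invariants c G"
  assumes "poisson_algebra K (pol_poisson br)"
    and "quadratic br"
    and "unimodular br"
    and "\<And>i j. br (pvar i) (pvar j) =
           (\<Sum>k\<in>UNIV. \<Sum>l\<in>UNIV. pconst (c i j k l) * (pvar k * pvar l))"
    and "subgroup G (graded_poisson_Aut br)"
    and "finite G"
  shows
    "isomorphic_algebras K (residue_algebra c G) (pol_invariants br G) \<and>
     (\<forall>f \<in> carrier Q. \<forall>g \<in> carrier Q. \<exists>h \<in> carrier Q. f \<otimes> g \<ominus> g \<otimes> f = hbar c \<otimes> h) \<and>
     (\<forall>\<pi>\<^sub>1. (\<forall>f \<in> carrier Q. \<forall>g \<in> carrier Q.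
           \<pi>\<^sub>1 f g \<in> carrier Q \<and> f \<otimes> g \<ominus> g \<otimes> f = hbar c \<otimes> \<pi>\<^sub>1 f g) \<longrightarrow>
       (\<exists>B. (\<forall>f \<in> carrier Q. \<forall>g \<in> carrier Q.
              B (residue_class c G f) (residue_class c G g) = residue_class c G (\<pi>\<^sub>1 f g)) \<and>
            isomorphic_poisson_algebras K
              (with_bracket (residue_algebra c G) B) (pol_invariants br G)))"
proof -
  interpret quantized_action br c G
    by (intro quantized_action.intro quantized_bracket.intro quantized_action_axioms.intro)
      (use assms(3,6-8) in \<open>simp_all only: K_def\<close>)
  show ?thesis
    unfolding K_def Q_def
    by (rule conjI[OF residue_algebra_isomorphic], rule conjI)
      (use commutator_divisible_by_hbar residue_algebra_poisson_isomorphic in blast)+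
qed

end
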